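(* Let $X$ be a curve over a finite field, $P,Q$ distinct rational points and $B$ a divisor. For all integers $a,b$, \[ \dim L(B+aP+bQ)=\#\{(i,j)\in\mathbb{Z}^2 : i\leq a,\ j\leq b,\ B+iP+jQ\in\mathcal{D}(P,Q)\}. \]
   Context: $L(E)=\{f:(f)+E\geq0\}\cup\{0\}$. The set of discrepancies $\mathcal{D}(P,Q)$ is the set of divisor classes $A$ with $L(A)\neq L(A-P)$ and $L(A-Q)=L(A-Q-P)$ (equivalently $L(A)\neq L(A-Q)$ and $L(A-P)=L(A-P-Q)$). *)

theory Defs
  imports
    Complex_Main
    "HOL-Computational_Algebra.Polynomial"
    "HOL-Algebra.Free_Abelian_Groups"
begin

text \<open>
  A (smooth, projective) curve \<open>X\<close> over a field \<open>k\<close> is given by its function field: an extension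
  \<open>\<iota> : k \<rightarrow> F\<close> that is finite over \<open>k(x)\<close> for some \<open>x\<close> transcendental over \<open>k\<close>.  The closed points
  of \<open>X\<close> are the discrete valuation rings of \<open>F/k\<close>, that is, the normalised discrete valuations of
  \<open>F\<close> that are trivial on \<open>k\<close>.
\<close>

definition simple_field_ext :: "('k::field \<Rightarrow> 'f::field) \<Rightarrow> 'f \<Rightarrow> 'f set" where
  "simple_field_ext \<iota> x =
     {poly (map_poly \<iota> p) x / poly (map_poly \<iota> q) x | p q. poly (map_poly \<iota> q) x \<noteq> 0}"

definition transcendental_over :: "('k::field \<Rightarrow> 'f::field) \<Rightarrow> 'f \<Rightarrow> bool" where
  "transcendental_over \<iota> x \<longleftrightarrow> (\<forall>p. p \<noteq> 0 \<longrightarrow> poly (map_poly \<iota> p) x \<noteq> 0)"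

text \<open>
  That \<open>k\<close> is algebraically closed in \<open>F\<close> (for finite \<open>k\<close>: that \<open>X\<close> is absolutely irreducible) is
  not assumed; it is automatic as soon as \<open>X\<close> has a \<open>k\<close>-rational point.
\<close>

locale function_field =
  fixes \<iota> :: "'k::field \<Rightarrow> 'f::field"
  assumes emb_one: "\<iota> 1 = 1"
    and emb_add: "\<iota> (c + d) = \<iota> c + \<iota> d"
    and emb_mult: "\<iota> (c * d) = \<iota> c * \<iota> d"
    and finite_over_rational_function_field:
      "\<exists>x. transcendental_over \<iota> x \<and>
           (\<exists>S. finite S \<and>
                (\<forall>f. \<exists>c. (\<forall>s\<in>S. c s \<in> simple_field_ext \<iota> x) \<and> f = (\<Sum>s\<in>S. c s * s)))"

text \<open>
  The value at \<open>0\<close>, mathematically \<open>\<infinity>\<close>, is fixed to be \<open>0\<close> so that a point corresponds to exactly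
  one function.
\<close>

definition points :: "('k::field \<Rightarrow> 'f::field) \<Rightarrow> ('f \<Rightarrow> int) set" where
  "points \<iota> =
     {v. v 0 = 0 \<and>
         (\<forall>f g. f \<noteq> 0 \<longrightarrow> g \<noteq> 0 \<longrightarrow> v (f * g) = v f + v g) \<and>
         (\<forall>f g. f \<noteq> 0 \<longrightarrow> g \<noteq> 0 \<longrightarrow> f + g \<noteq> 0 \<longrightarrow> min (v f) (v g) \<le> v (f + g)) \<and>
         (\<forall>c. c \<noteq> 0 \<longrightarrow> v (\<iota> c) = 0) \<and>
         (\<exists>t. t \<noteq> 0 \<and> v t = 1)}"

definition local_ring :: "('f::field \<Rightarrow> int) \<Rightarrow> 'f set" where
  "local_ring v = {f. f \<noteq> 0 \<longrightarrow> 0 \<le> v f}"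

definition max_ideal :: "('f::field \<Rightarrow> int) \<Rightarrow> 'f set" where
  "max_ideal v = {f. f \<noteq> 0 \<longrightarrow> 0 < v f}"

text \<open>
  A point is rational if its residue field is \<open>k\<close>, i.e.\ if the (always injective) map from \<open>k\<close> to
  the local ring modulo its maximal ideal is surjective.
\<close>

definition rational_points :: "('k::field \<Rightarrow> 'f::field) \<Rightarrow> ('f \<Rightarrow> int) set" where
  "rational_points \<iota> = {v \<in> points \<iota>. \<forall>f \<in> local_ring v. \<exists>c. f - \<iota> c \<in> max_ideal v}"

abbreviation divisor_group :: "('k::field \<Rightarrow> 'f::field) \<Rightarrow> (('f \<Rightarrow> int) \<Rightarrow>\<^sub>0 int) monoid" where
  "divisor_group \<iota> \<equiv> free_Abelian_group (points \<iota>)"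

abbreviation divisors :: "('k::field \<Rightarrow> 'f::field) \<Rightarrow> (('f \<Rightarrow> int) \<Rightarrow>\<^sub>0 int) set" where
  "divisors \<iota> \<equiv> carrier (divisor_group \<iota>)"

text \<open>The coefficient of the divisor \<open>(f)\<close> at the point \<open>v\<close> is \<open>v f\<close>.\<close>

definition principal_divisors ::
    "('k::field \<Rightarrow> 'f::field) \<Rightarrow> (('f \<Rightarrow> int) \<Rightarrow>\<^sub>0 int) set" where
  "principal_divisors \<iota> =
     {D \<in> divisors \<iota>. \<exists>f. f \<noteq> 0 \<and> (\<forall>v \<in> points \<iota>. Poly_Mapping.lookup D v = v f)}"

definition divisor_class ::
    "('k::field \<Rightarrow> 'f::field) \<Rightarrow> (('f \<Rightarrow> int) \<Rightarrow>\<^sub>0 int) \<Rightarrow> (('f \<Rightarrow> int) \<Rightarrow>\<^sub>0 int) set" where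
  "divisor_class \<iota> A = principal_divisors \<iota> #>\<^bsub>divisor_group \<iota>\<^esub> A"

definition RR_space ::
    "('k::field \<Rightarrow> 'f::field) \<Rightarrow> (('f \<Rightarrow> int) \<Rightarrow>\<^sub>0 int) \<Rightarrow> 'f set" where
  "RR_space \<iota> E =
     {f. f \<noteq> 0 \<and> (\<forall>v \<in> points \<iota>. 0 \<le> v f + Poly_Mapping.lookup E v)} \<union> {0}"

definition discrepancies ::
    "('k::field \<Rightarrow> 'f::field) \<Rightarrow> ('f \<Rightarrow> int) \<Rightarrow> ('f \<Rightarrow> int) \<Rightarrow> (('f \<Rightarrow> int) \<Rightarrow>\<^sub>0 int) set set" where
  "discrepancies \<iota> P Q =
     {divisor_class \<iota> A | A.
        A \<in> divisors \<iota> \<and>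
        RR_space \<iota> A \<noteq> RR_space \<iota> (A - frag_of P) \<and>
        RR_space \<iota> (A - frag_of Q) = RR_space \<iota> (A - frag_of Q - frag_of P)}"

definition const_scale :: "('k::field \<Rightarrow> 'f::field) \<Rightarrow> 'k \<Rightarrow> 'f \<Rightarrow> 'f" where
  "const_scale \<iota> c f = \<iota> c * f"

lemma (in function_field) vector_space_const_scale: "vector_space (const_scale \<iota>)"
  by unfold_locales
    (simp_all add: const_scale_def emb_one emb_add emb_mult algebra_simps)

end

theory Submission
  imports Defs "HOL-Library.Cardinality"
begin

text \<open>
  Fix \<open>b\<close>. As \<open>P\<close> is rational, \<open>dim L(B + iP + bQ)\<close> grows by at most one when \<open>i\<close> increases by
  one, and it vanishes for \<open>i\<close> very negative; so it counts the \<open>i \<le> a\<close> at which it jumps. A jump at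
  \<open>(i, j)\<close> persists for all larger \<open>j\<close> and does not occur for \<open>j\<close> very negative. Hence each jump at
  \<open>(i, b)\<close> comes from exactly one \<open>j \<le> b\<close> where a jump at \<open>(i, j)\<close> appears but none at
  \<open>(i, j - 1)\<close>, that is, from one discrepancy.

  The vanishing follows from finiteness of the spaces \<open>L(A)\<close>, which rests on two facts: residue
  fields of points are finite, and a function with a zero has a pole. For the latter, a maximal
  subring containing \<open>k\<close> and \<open>1/g\<close> but not \<open>g\<close> is a valuation ring. Both this ring's discreteness and
  the finiteness of residue fields come from the fact that \<open>F\<close> has finite rank over \<open>k[t]\<close> for every \<open>t\<close>,
  which is proved by counting, \<open>k\<close> being finite.
\<close>

locale finite_function_field = function_field \<iota>
  for \<iota> :: "'k::{field,finite} \<Rightarrow> 'f::field"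
begin

section \<open>Constants and evaluation of polynomials over \<open>k\<close>\<close>

lemma emb_zero [simp]: "\<iota> 0 = 0"
  by (metis add_0 add_cancel_right_right emb_add)

lemma emb_minus: "\<iota> (- c) = - \<iota> c"
  using emb_add[of c "- c"] by (simp add: eq_neg_iff_add_eq_0 add.commute)

lemma emb_inverse: "c \<noteq> 0 \<Longrightarrow> \<iota> (inverse c) * \<iota> c = 1"
  by (metis emb_mult emb_one left_inverse)

lemma emb_eq_0_iff [simp]: "\<iota> c = 0 \<longleftrightarrow> c = 0"
  using emb_inverse[of c] by force

definition ev :: "'k poly \<Rightarrow> 'f \<Rightarrow> 'f" where
  "ev p t = poly (map_poly \<iota> p) t"

lemma ev_0 [simp]: "ev 0 t = 0"
  by (simp add: ev_def)

lemma ev_pCons [simp]: "ev (pCons c p) t = \<iota> c + t * ev p t"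
  by (simp add: ev_def map_poly_pCons)

lemma ev_1 [simp]: "ev 1 t = 1"
  by (simp add: ev_def emb_one)

lemma ev_add: "ev (p + q) t = ev p t + ev q t"
  by (induction p q rule: poly_induct2) (simp_all add: emb_add algebra_simps)

lemma ev_minus: "ev (- p) t = - ev p t"
  using ev_add[of p "- p" t] by (simp add: eq_neg_iff_add_eq_0 add.commute)

lemma ev_diff: "ev (p - q) t = ev p t - ev q t"
  using ev_add[of p "- q"] by (simp add: ev_minus)

lemma ev_smult: "ev (smult c p) t = \<iota> c * ev p t"
  by (induction p) (simp_all add: emb_mult algebra_simps)

lemma ev_mult: "ev (p * q) t = ev p t * ev q t"
  by (induction p) (simp_all add: ev_add ev_smult algebra_simps)

text \<open>The bound \<open>N\<close> is free rather than the degree, so that polynomials of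
  different degrees can be expanded over one common index range.\<close>

lemma ev_altdef:
  assumes "degree p \<le> N"
  shows "ev p t = (\<Sum>j\<le>N. \<iota> (coeff p j) * t ^ j)"
  using assms
proof (induction N arbitrary: p)
  case 0
  then obtain c where "p = [:c:]"
    by (metis degree_eq_zeroE le_zero_eq)
  then show ?case by simp
next
  case (Suc N)
  obtain c p' where p: "p = pCons c p'" by (cases p)
  have "degree p' \<le> N"
    using Suc.prems p by (auto split: if_splits)
  from Suc.IH[OF this] show ?case
    by (simp add: p sum.atMost_Suc_shift sum_distrib_left mult_ac del: sum.atMost_Suc)
qed

section \<open>Finite rank of \<open>F\<close> over \<open>k[t]\<close>\<close>

lemma finite_card_bounded_degree_polys:
  "finite {p :: 'k poly. degree p \<le> N} \<and> card {p :: 'k poly. degree p \<le> N} = CARD('k) ^ Suc N"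
proof (induction N)
  case 0
  have eq: "{p :: 'k poly. degree p \<le> 0} = range (\<lambda>c. [:c:])"
    by (auto elim!: degree_eq_zeroE)
  have "inj (\<lambda>c :: 'k. [:c:])" by (simp add: inj_def)
  then show ?case unfolding eq by (simp add: card_image)
next
  case (Suc N)
  have eq: "{p :: 'k poly. degree p \<le> Suc N}
      = (\<lambda>(c, p). pCons c p) ` (UNIV \<times> {p. degree p \<le> N})" (is "?A = ?g ` ?B")
  proof
    show "?A \<subseteq> ?g ` ?B"
    proof
      fix p :: "'k poly" assume "p \<in> ?A"
      then show "p \<in> ?g ` ?B"
        by (cases p) (force split: if_splits)
    qed
    show "?g ` ?B \<subseteq> ?A" by (auto intro: order_trans[OF degree_pCons_le])
  qed
  have "inj_on ?g ?B" by (auto simp: inj_on_def)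
  then show ?case unfolding eq using Suc.IH by (simp add: card_image card_cartesian_product)
qed

text \<open>
  If \<open>W r\<close> denotes the elements \<open>\<Sum> p\<^sub>s(x) s\<close> with \<open>deg p\<^sub>s \<le> r\<close>, multiplication by \<open>t\<close> maps
  \<open>W r\<close> into \<open>W (r + C)\<close> up to a fixed denominator, so the elements \<open>t\<^sup>j u\<^sub>i\<close>
  with \<open>i \<le> M\<close> and \<open>j \<le> N\<close> lie in a space of dimension \<open>|S| C N + O(1)\<close>; they are dependent
  as soon as \<open>M \<ge> |S| C\<close> and \<open>N\<close> is large.
\<close>
lemma dependent_over_polynomials:
  "\<exists>M. \<forall>u :: nat \<Rightarrow> 'f. \<exists>p. (\<exists>i\<le>M. p i \<noteq> 0) \<and> (\<Sum>i\<le>M. ev (p i) t * u i) = 0"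
proof -
  obtain x S where S: "finite S"
    and gen: "\<And>f. \<exists>c. (\<forall>s\<in>S. c s \<in> simple_field_ext \<iota> x) \<and> f = (\<Sum>s\<in>S. c s * s)"
    using finite_over_rational_function_field by blast
  define W where "W r = {\<Sum>s\<in>S. ev (p s) x * s | p. \<forall>s\<in>S. degree (p s) \<le> r}" for r
  have W_I: "(\<Sum>s\<in>S. ev (p s) x * s) \<in> W r" if "\<And>s. s \<in> S \<Longrightarrow> degree (p s) \<le> r" for p r
    using that unfolding W_def by blast
  have W_mono: "w \<in> W r'" if "w \<in> W r" "r \<le> r'" for w r r'
    using that unfolding W_def by (blast intro: order_trans)
  have W_0: "0 \<in> W r" for r
    using W_I[of "\<lambda>_. 0" r] by simp
  have W_add: "w + w' \<in> W r" if w_in: "w \<in> W r" "w' \<in> W r" for w w' r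
  proof -
    obtain p p' where "w = (\<Sum>s\<in>S. ev (p s) x * s)" "\<forall>s\<in>S. degree (p s) \<le> r"
      "w' = (\<Sum>s\<in>S. ev (p' s) x * s)" "\<forall>s\<in>S. degree (p' s) \<le> r"
      using w_in unfolding W_def by blast
    then show ?thesis
      using W_I[of "\<lambda>s. p s + p' s" r]
      by (simp add: ev_add distrib_right sum.distrib degree_add_le)
  qed
  have W_sum: "(\<Sum>i\<in>I. w i) \<in> W r" if "\<And>i. i \<in> I \<Longrightarrow> w i \<in> W r" for I r and w :: "'c \<Rightarrow> 'f"
    using that by (induction I rule: infinite_finite_induct) (auto intro: W_0 W_add)
  have W_mult: "ev d x * w \<in> W (r + m)" if w_in: "w \<in> W r" and d: "degree d \<le> m" for d w r m
  proof -
    obtain p where w: "w = (\<Sum>s\<in>S. ev (p s) x * s)" and p: "\<forall>s\<in>S. degree (p s) \<le> r"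
      using w_in unfolding W_def by blast
    have "degree (d * p s) \<le> r + m" if "s \<in> S" for s
      using degree_mult_le[of d "p s"] p d that by fastforce
    then show ?thesis
      using W_I[of "\<lambda>s. d * p s" "r + m"] w by (simp add: ev_mult sum_distrib_left mult.assoc)
  qed
  have W_scale: "\<iota> c * w \<in> W r" if "w \<in> W r" for c w r
    using W_mult[OF that, of "[:c:]" 0] by simp
  have W_basis: "s \<in> W 0" if "s \<in> S" for s
  proof -
    have "(\<Sum>s'\<in>S. ev (if s' = s then 1 else 0) x * s') = (\<Sum>s'\<in>S. if s' = s then s' else 0)"
      by (rule sum.cong) auto
    also have "\<dots> = s" using S that by simp
    finally show ?thesis using W_I[of "\<lambda>s'. if s' = s then 1 else 0" 0] by simp
  qed
  \<comment> \<open>Multiplying the denominators reduces the claim for a finite set to its elements.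
    It is applied to the terms \<open>c s * s\<close>, to the products \<open>t * s\<close> and to
    the values \<open>u i\<close>.\<close>
  have common_denom: "\<exists>d r. ev d x \<noteq> 0 \<and> (\<forall>f\<in>A. ev d x * f \<in> W r)"
    if "finite A" "\<And>f. f \<in> A \<Longrightarrow> \<exists>d r. ev d x \<noteq> 0 \<and> ev d x * f \<in> W r" for A
    using that
  proof (induction A rule: finite_induct)
    case empty
    show ?case by (rule exI[of _ 1]) simp
  next
    case (insert f A)
    obtain d r where d: "ev d x \<noteq> 0" "\<forall>f\<in>A. ev d x * f \<in> W r"
      using insert.IH insert.prems by auto
    obtain d' r' where d': "ev d' x \<noteq> 0" "ev d' x * f \<in> W r'"
      using insert.prems[of f] by auto
    define R where "R = (r + degree d') + (r' + degree d)"
    have "ev (d' * d) x * g \<in> W R" if "g \<in> A" for g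
      using W_mono[OF W_mult[of "ev d x * g" r d' "degree d'"], of R] d(2) that
      by (simp add: R_def ev_mult mult.assoc)
    moreover have "ev (d' * d) x * f \<in> W R"
      using W_mono[OF W_mult[of "ev d' x * f" r' d "degree d"], of R] d'(2)
      by (simp add: R_def ev_mult mult_ac)
    ultimately show ?case
      using d(1) d'(1) by (intro exI[of _ "d' * d"] exI[of _ R]) (auto simp: ev_mult)
  qed
  have denom: "\<exists>d r. ev d x \<noteq> 0 \<and> ev d x * f \<in> W r" for f
  proof -
    obtain c where c: "\<forall>s\<in>S. c s \<in> simple_field_ext \<iota> x" and f: "f = (\<Sum>s\<in>S. c s * s)"
      using gen by blast
    have "\<exists>d r. ev d x \<noteq> 0 \<and> ev d x * (c s * s) \<in> W r" if s: "s \<in> S" for s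
    proof -
      obtain p q where pq: "c s = ev p x / ev q x" "ev q x \<noteq> 0"
        using c s unfolding simple_field_ext_def ev_def by blast
      then have "ev q x * (c s * s) = ev p x * s" by simp
      then show ?thesis
        using pq(2) W_mult[OF W_basis[OF s], of p "degree p"]
        by (intro exI[of _ q] exI[of _ "degree p"]) (simp only: add_0 order_refl simp_thms)
    qed
    then have "\<exists>d r. ev d x \<noteq> 0 \<and> (\<forall>g\<in>(\<lambda>s. c s * s) ` S. ev d x * g \<in> W r)"
      using S by (intro common_denom) blast+
    then obtain d r where d: "ev d x \<noteq> 0" "\<forall>g\<in>(\<lambda>s. c s * s) ` S. ev d x * g \<in> W r"
      by blast
    have "ev d x * f \<in> W r"
      unfolding f sum_distrib_left by (rule W_sum) (use d in auto)
    then show ?thesis using d by blast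
  qed
  obtain d r1 where d: "ev d x \<noteq> 0" "\<forall>f\<in>(\<lambda>s. t * s) ` S. ev d x * f \<in> W r1"
    using common_denom[of "(\<lambda>s. t * s) ` S"] S denom by auto
  \<comment> \<open>\<open>C\<close> bounds the degree growth both under multiplication by
    \<open>ev d x * t\<close> and by \<open>ev d x\<close> alone, so in \<open>mult_power\<close>
    one power of \<open>ev d x\<close> clears the denominators of all \<open>t ^ j * w\<close> with
    \<open>j \<le> N\<close>.\<close>
  define C where "C = r1 + degree d"
  have mult_t: "ev d x * (t * w) \<in> W (r + C)" if w_in: "w \<in> W r" for w r
  proof -
    obtain p where w: "w = (\<Sum>s\<in>S. ev (p s) x * s)" and p: "\<forall>s\<in>S. degree (p s) \<le> r"
      using w_in unfolding W_def by blast
    have "ev (p s) x * (ev d x * (t * s)) \<in> W (r + C)" if "s \<in> S" for s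
      using d(2) p that W_mono[OF W_mult[of "ev d x * (t * s)" r1 "p s" r], of "r + C"]
      by (simp add: C_def)
    then have "(\<Sum>s\<in>S. ev (p s) x * (ev d x * (t * s))) \<in> W (r + C)"
      by (rule W_sum)
    then show ?thesis unfolding w by (simp add: sum_distrib_left mult_ac)
  qed
  have mult_power: "ev d x ^ N * (t ^ j * w) \<in> W (r + N * C)" if "w \<in> W r" "j \<le> N" for w r j N
    using that(2)
  proof (induction N arbitrary: j)
    case 0
    then show ?case using that by simp
  next
    case (Suc N)
    show ?case
    proof (cases "j = Suc N")
      case True
      have "ev d x * (t * (ev d x ^ N * (t ^ N * w))) \<in> W ((r + N * C) + C)"
        by (rule mult_t[OF Suc.IH]) simp
      then show ?thesis using True by (simp add: mult_ac add_ac)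
    next
      case False
      then have "j \<le> N" using Suc.prems by simp
      then have "ev d x * (ev d x ^ N * (t ^ j * w)) \<in> W ((r + N * C) + C)"
        by (intro W_mult Suc.IH) (auto simp: C_def)
      then show ?thesis by (simp add: mult_ac add_ac)
    qed
  qed
  define n where "n = card S"
  define M where "M = n * C"
  have "\<exists>p. (\<exists>i\<le>M. p i \<noteq> 0) \<and> (\<Sum>i\<le>M. ev (p i) t * u i) = 0" for u :: "nat \<Rightarrow> 'f"
  proof -
    obtain e r where e: "ev e x \<noteq> 0" "\<forall>f\<in>u ` {..M}. ev e x * f \<in> W r"
      using common_denom[of "u ` {..M}"] denom by auto
    \<comment> \<open>Pigeonhole: a family in \<open>T\<close> has \<open>(N + 1) * (M + 1)\<close>
      coefficients, while an element of \<open>W (r + N * C)\<close> is given by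
      \<open>n * (r + N * C + 1)\<close>. This \<open>N\<close> makes the former number larger by
      \<open>n * C + 1\<close>.\<close>
    define N where "N = n * (r + 1)"
    define T where "T = PiE {..M} (\<lambda>_. {p :: 'k poly. degree p \<le> N})"
    \<comment> \<open>The factor that clears denominators does not depend on \<open>p\<close>, so
      two families with equal images differ by a relation.\<close>
    define \<Phi> where "\<Phi> p = ev d x ^ N * ev e x * (\<Sum>i\<le>M. ev (p i) t * u i)" for p
    have W_image: "W m = (\<lambda>p. \<Sum>s\<in>S. ev (p s) x * s) ` (PiE S (\<lambda>_. {p. degree p \<le> m}))" for m
    proof
      show "W m \<subseteq> (\<lambda>p. \<Sum>s\<in>S. ev (p s) x * s) ` (PiE S (\<lambda>_. {p. degree p \<le> m}))"
      proof
        fix w assume "w \<in> W m"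
        then obtain p where "w = (\<Sum>s\<in>S. ev (p s) x * s)" "\<forall>s\<in>S. degree (p s) \<le> m"
          unfolding W_def by blast
        then show "w \<in> (\<lambda>p. \<Sum>s\<in>S. ev (p s) x * s) ` (PiE S (\<lambda>_. {p. degree p \<le> m}))"
          by (intro image_eqI[of _ _ "restrict p S"]) (auto intro!: sum.cong)
      qed
    qed (auto intro!: W_I)
    have W_finite: "finite (W m)" and W_card: "card (W m) \<le> (CARD('k) ^ Suc m) ^ n" for m
    proof -
      have fin: "finite (PiE S (\<lambda>_. {p :: 'k poly. degree p \<le> m}))"
        using S finite_card_bounded_degree_polys by (intro finite_PiE) auto
      then show "finite (W m)" unfolding W_image by simp
      have "card (W m) \<le> card (PiE S (\<lambda>_. {p :: 'k poly. degree p \<le> m}))"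
        unfolding W_image by (rule card_image_le[OF fin])
      also have "\<dots> = (CARD('k) ^ Suc m) ^ n"
        using finite_card_bounded_degree_polys by (simp add: card_PiE[OF S] n_def)
      finally show "card (W m) \<le> (CARD('k) ^ Suc m) ^ n" .
    qed
    have \<Phi>: "\<Phi> ` T \<subseteq> W (r + N * C)"
    proof safe
      fix p assume p: "p \<in> T"
      have "\<Phi> p = (\<Sum>i\<le>M. ev d x ^ N * (ev (p i) t * (ev e x * u i)))"
        by (simp add: \<Phi>_def sum_distrib_left mult_ac)
      also have "\<dots> = (\<Sum>i\<le>M. \<Sum>j\<le>N. \<iota> (coeff (p i) j) * (ev d x ^ N * (t ^ j * (ev e x * u i))))"
      proof (rule sum.cong[OF refl])
        fix i assume "i \<in> {..M}"
        then have "degree (p i) \<le> N" using p by (auto simp: T_def)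
        from ev_altdef[OF this]
        show "ev d x ^ N * (ev (p i) t * (ev e x * u i))
            = (\<Sum>j\<le>N. \<iota> (coeff (p i) j) * (ev d x ^ N * (t ^ j * (ev e x * u i))))"
          by (simp add: sum_distrib_left sum_distrib_right mult_ac)
      qed
      also have "\<dots> \<in> W (r + N * C)"
        using e(2) by (intro W_sum W_scale mult_power) auto
      finally show "\<Phi> p \<in> W (r + N * C)" .
    qed
    have q: "1 < CARD('k)"
    proof -
      have "card {0, 1 :: 'k} \<le> CARD('k)" by (rule card_mono) auto
      then show ?thesis by simp
    qed
    have "card (W (r + N * C)) \<le> CARD('k) ^ (Suc (r + N * C) * n)"
      using W_card[of "r + N * C"] by (simp only: power_mult)
    also have "\<dots> < CARD('k) ^ (Suc N * Suc M)"
      using q by (intro power_strict_increasing) (simp_all add: M_def N_def algebra_simps)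
    also have "\<dots> = (CARD('k) ^ Suc N) ^ Suc M" by (simp only: power_mult)
    also have "\<dots> = card T"
      using finite_card_bounded_degree_polys[of N] by (simp add: T_def card_PiE)
    finally have "\<not> inj_on \<Phi> T"
      using card_inj_on_le[OF _ \<Phi> W_finite] by auto
    then obtain p p' where pp: "p \<in> T" "p' \<in> T" "\<Phi> p = \<Phi> p'" "p \<noteq> p'"
      by (auto simp: inj_on_def)
    have "\<exists>i\<le>M. p i - p' i \<noteq> 0"
      using pp PiE_ext[of p "{..M}" _ p'] unfolding T_def by fastforce
    moreover have "(\<Sum>i\<le>M. ev (p i - p' i) t * u i) = 0"
      using pp(3) d(1) e(1) by (simp add: \<Phi>_def ev_diff left_diff_distrib sum_subtractf)
    ultimately show ?thesis by (intro exI[of _ "\<lambda>i. p i - p' i"]) blast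
  qed
  then show ?thesis by blast
qed

text \<open>As long as all constant coefficients vanish, the relation can be divided by
  \<open>t\<close>, which lowers the total degree. A nonzero constant coefficient makes
  \<open>ev (p i) t\<close> a unit in a valuation ring where \<open>t\<close> is a nonunit.\<close>

lemma dependent_over_polynomials_normalised:
  assumes "t \<noteq> 0"
  shows "\<exists>M. \<forall>u :: nat \<Rightarrow> 'f. \<exists>p. (\<exists>i\<le>M. coeff (p i) 0 \<noteq> 0) \<and> (\<Sum>i\<le>M. ev (p i) t * u i) = 0"
proof -
  obtain M where M: "\<And>u :: nat \<Rightarrow> 'f. \<exists>p. (\<exists>i\<le>M. p i \<noteq> 0) \<and> (\<Sum>i\<le>M. ev (p i) t * u i) = 0"
    using dependent_over_polynomials by blast
  have "\<exists>p. (\<exists>i\<le>M. coeff (p i) 0 \<noteq> 0) \<and> (\<Sum>i\<le>M. ev (p i) t * u i) = 0" for u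
  proof -
    have "\<exists>p. (\<exists>i\<le>M. coeff (p i) 0 \<noteq> 0) \<and> (\<Sum>i\<le>M. ev (p i) t * u i) = 0"
      if "\<exists>i\<le>M. p i \<noteq> 0" "(\<Sum>i\<le>M. ev (p i) t * u i) = 0" for p
      using that
    proof (induction "\<Sum>i\<le>M. degree (p i)" arbitrary: p rule: less_induct)
      case less
      show ?case
      proof (cases "\<exists>i\<le>M. coeff (p i) 0 \<noteq> 0")
        case True
        then show ?thesis using less.prems by blast
      next
        case False
        define p' where "p' i = (if i \<le> M then poly_shift 1 (p i) else 0)" for i
        have p: "p i = pCons 0 (p' i)" if "i \<le> M" for i
          using that False
          by (auto simp: p'_def poly_eq_iff coeff_pCons coeff_poly_shift split: nat.splits)
        have nz: "\<exists>i\<le>M. p' i \<noteq> 0"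
          using less.prems(1) p by fastforce
        have "t * (\<Sum>i\<le>M. ev (p' i) t * u i) = (\<Sum>i\<le>M. ev (p i) t * u i)"
          by (simp add: p sum_distrib_left mult.assoc)
        then have sum: "(\<Sum>i\<le>M. ev (p' i) t * u i) = 0"
          using less.prems(2) assms by simp
        \<comment> \<open>An index with \<open>p' i \<noteq> 0\<close> loses one degree; where
          \<open>p' i = 0\<close> both degrees are \<open>0\<close>.\<close>
        have "(\<Sum>i\<le>M. degree (p' i)) < (\<Sum>i\<le>M. degree (p i))"
          using nz by (intro sum_strict_mono_ex1) (auto simp: p degree_pCons_eq_if)
        from less.hyps[OF this nz sum] show ?thesis .
      qed
    qed
    then show ?thesis using M by blast
  qed
  then show ?thesis by blast
qed

subsection \<open>Valuation rings\<close>

text \<open>Closure under negation and membership of \<open>1\<close> follow because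
  \<open>range \<iota>\<close> contains \<open>-1\<close> and \<open>1\<close>.\<close>

definition subalgebra :: "'f set \<Rightarrow> bool" where
  "subalgebra R \<longleftrightarrow> range \<iota> \<subseteq> R \<and> (\<forall>f\<in>R. \<forall>g\<in>R. f + g \<in> R) \<and> (\<forall>f\<in>R. \<forall>g\<in>R. f * g \<in> R)"

context
  fixes R
  assumes R: "subalgebra R"
begin

lemma subalgebra_const: "\<iota> c \<in> R"
  and subalgebra_add: "f \<in> R \<Longrightarrow> g \<in> R \<Longrightarrow> f + g \<in> R"
  and subalgebra_mult: "f \<in> R \<Longrightarrow> g \<in> R \<Longrightarrow> f * g \<in> R"
  using R by (auto simp: subalgebra_def)

lemma subalgebra_0: "0 \<in> R"
  using subalgebra_const[of 0] by simp

lemma subalgebra_1: "1 \<in> R"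
  using subalgebra_const[of 1] by (simp add: emb_one)

lemma subalgebra_minus: "f \<in> R \<Longrightarrow> - f \<in> R"
  using subalgebra_mult[OF subalgebra_const[of "- 1"]] by (simp add: emb_minus emb_one)

lemma subalgebra_diff: "f \<in> R \<Longrightarrow> g \<in> R \<Longrightarrow> f - g \<in> R"
  using subalgebra_add[OF _ subalgebra_minus] by simp

lemma subalgebra_power: "f \<in> R \<Longrightarrow> f ^ n \<in> R"
  by (induction n) (auto intro: subalgebra_1 subalgebra_mult)

lemma subalgebra_sum: "(\<And>i. i \<in> I \<Longrightarrow> h i \<in> R) \<Longrightarrow> sum h I \<in> R"
  by (induction I rule: infinite_finite_induct) (auto intro: subalgebra_0 subalgebra_add)

lemma subalgebra_ev: "f \<in> R \<Longrightarrow> ev p f \<in> R"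
  by (induction p) (auto intro: subalgebra_0 subalgebra_const subalgebra_add subalgebra_mult)

lemmas subalgebra_intros = subalgebra_const subalgebra_add subalgebra_mult subalgebra_0
  subalgebra_1 subalgebra_minus subalgebra_diff subalgebra_power subalgebra_sum subalgebra_ev

end

text \<open>The point is discreteness. Finite rank over \<open>k[y]\<close> for a nonunit
  \<open>y\<close> bounds the length of strict divisor chains, which yields a uniformiser
  \<open>\<pi>\<close>; it also excludes nonzero elements divisible by all powers of
  \<open>\<pi>\<close>. The exponent of \<open>\<pi>\<close> is then the valuation.\<close>

lemma valuation_ring_is_local_ring_of_point:
  assumes R: "subalgebra R" and val: "\<And>f. f \<in> R \<or> inverse f \<in> R" and "R \<noteq> UNIV"
  shows "\<exists>v\<in>points \<iota>. local_ring v = R"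
proof -
  note R_intros = subalgebra_intros[OF R]
  \<comment> \<open>The nonunits of \<open>R\<close>. Zero is listed separately because
    \<open>inverse 0 = 0\<close> lies in \<open>R\<close>.\<close>
  define \<mm> where "\<mm> = {f \<in> R. f = 0 \<or> inverse f \<notin> R}"
  obtain z where "z \<notin> R" using \<open>R \<noteq> UNIV\<close> by auto
  define y where "y = inverse z"
  have y: "y \<noteq> 0" "y \<in> \<mm>"
    using val[of z] \<open>z \<notin> R\<close> R_intros(4) by (auto simp: y_def \<mm>_def)
  have m_R: "f \<in> R" if "f \<in> \<mm>" for f
    using that by (simp add: \<mm>_def)
  have m_mult: "r * f \<in> \<mm>" if r: "r \<in> R" and f: "f \<in> \<mm>" for r f
  proof (rule ccontr)
    assume neg: "r * f \<notin> \<mm>"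
    moreover have "r * f \<in> R" using r f by (auto simp: \<mm>_def intro: R_intros)
    ultimately have nz: "r * f \<noteq> 0" and "inverse (r * f) \<in> R" by (auto simp: \<mm>_def)
    then have "r * inverse (r * f) \<in> R" using r by (auto intro: R_intros)
    moreover have "r * inverse (r * f) = inverse f" using nz by (simp add: field_simps)
    ultimately have "inverse f \<in> R" by (simp only:)
    then show False using f nz by (auto simp: \<mm>_def)
  qed
  have m_add: "f + g \<in> \<mm>" if f: "f \<in> \<mm>" and g: "g \<in> \<mm>" for f g
  proof (cases "f = 0 \<or> g = 0")
    case True
    then show ?thesis using f g by auto
  next
    case False
    have "f / g \<in> R \<or> g / f \<in> R" using val[of "f / g"] by simp
    then show ?thesis
    proof
      assume "f / g \<in> R"
      then have "(f / g + 1) * g \<in> \<mm>" using g by (intro m_mult R_intros) auto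
      then show ?thesis using False by (simp add: distrib_right)
    next
      assume "g / f \<in> R"
      then have "(1 + g / f) * f \<in> \<mm>" using f by (intro m_mult R_intros) auto
      then show ?thesis using False by (simp add: distrib_right)
    qed
  qed
  have m_0: "0 \<in> \<mm>" by (simp add: \<mm>_def R_intros)
  have m_minus: "- f \<in> \<mm>" if "f \<in> \<mm>" for f
    using m_mult[OF R_intros(6)[OF R_intros(5)] that] by simp
  have m_sum: "sum h I \<in> \<mm>" if "\<And>i. i \<in> I \<Longrightarrow> h i \<in> \<mm>" for h :: "nat \<Rightarrow> 'f" and I
    using that by (induction I rule: infinite_finite_induct) (auto intro: m_0 m_add)
  have m_1: "1 \<notin> \<mm>" by (simp add: \<mm>_def R_intros)
  define U where "U = R - \<mm>"
  have U_iff: "w \<in> U \<longleftrightarrow> w \<noteq> 0 \<and> w \<in> R \<and> inverse w \<in> R" for w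
    by (auto simp: U_def \<mm>_def)
  have U_mult: "w * w' \<in> U" if "w \<in> U" "w' \<in> U" for w w'
    using that by (auto simp: U_iff intro: R_intros)
  have U_inverse: "inverse w \<in> U" if "w \<in> U" for w
    using that by (auto simp: U_iff)
  have const_U: "\<iota> c \<in> U" if "c \<noteq> 0" for c
  proof -
    have "inverse (\<iota> c) = \<iota> (inverse c)"
      using emb_inverse[OF that] that by (simp add: field_simps)
    then show ?thesis using that by (simp add: U_iff R_intros)
  qed
  \<comment> \<open>Modulo nonunits a polynomial in \<open>y\<close> equals its constant
    coefficient.\<close>
  have ev_U: "ev p y \<in> U" if "coeff p 0 \<noteq> 0" for p
  proof -
    obtain c p' where p: "p = pCons c p'" by (cases p)
    have c: "c \<noteq> 0" using that p by simp
    have m: "y * ev p' y \<in> \<mm>"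
      using m_mult[of "ev p' y" y] y m_R by (simp add: R_intros mult.commute)
    have "ev p y \<notin> \<mm>"
    proof
      assume "ev p y \<in> \<mm>"
      then have "ev p y + - (y * ev p' y) \<in> \<mm>" using m by (intro m_add m_minus)
      then show False using const_U[OF c] by (simp add: p U_def)
    qed
    moreover have "ev p y \<in> R" using y m_R by (intro R_intros) auto
    ultimately show ?thesis by (simp add: U_def)
  qed
  \<comment> \<open>Elements dividing \<open>y\<close> strictly and with distinct values are independent over \<open>k[y]\<close>.\<close>
  obtain M where M: "\<And>w. w 0 = y \<Longrightarrow> (\<And>i. i \<le> Suc M \<Longrightarrow> w i \<in> R - {0}) \<Longrightarrow>
      (\<And>i. i \<le> M \<Longrightarrow> w i / w (Suc i) \<in> \<mm>) \<Longrightarrow> False"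
  proof -
    obtain M where M: "\<And>u :: nat \<Rightarrow> 'f. \<exists>p. (\<exists>i\<le>M. coeff (p i) 0 \<noteq> 0) \<and> (\<Sum>i\<le>M. ev (p i) y * u i) = 0"
      using dependent_over_polynomials_normalised[OF y(1)] by blast
    have False if w0: "w 0 = y" and w: "\<And>i. i \<le> Suc M \<Longrightarrow> w i \<in> R - {0}"
      and step: "\<And>i. i \<le> M \<Longrightarrow> w i / w (Suc i) \<in> \<mm>" for w
    proof -
      have trans: "w i / w j \<in> \<mm>" if "i < j" "j \<le> Suc M" for i j
        using that
      proof (induction j)
        case 0
        then show ?case by simp
      next
        case (Suc j)
        show ?case
        proof (cases "i = j")
          case True
          then show ?thesis using step[of j] Suc.prems by simp
        next
          case False
          then have "w i / w j \<in> R" using Suc by (auto intro: m_R)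
          then have "w i / w j * (w j / w (Suc j)) \<in> \<mm>"
            using step[of j] Suc.prems by (intro m_mult) auto
          then show ?thesis using w[of j] Suc.prems by simp
        qed
      qed
      \<comment> \<open>The chain is shifted by one: \<open>w 0 = y\<close> is not one of the
        vectors in the relation, but divides every polynomial in \<open>y\<close> without constant
        coefficient.\<close>
      define u where "u i = w (Suc i)" for i
      obtain p where p: "\<exists>i\<le>M. coeff (p i) 0 \<noteq> 0" and sum: "(\<Sum>i\<le>M. ev (p i) y * u i) = 0"
        using M by blast
      define A where "A = {i. i \<le> M \<and> coeff (p i) 0 \<noteq> 0}"
      \<comment> \<open>After division by \<open>u i\<close> the relation has exactly one unit term.
        Terms before \<open>i\<close> are nonunits by the chain; terms after \<open>i\<close> have
        no constant coefficient, hence a factor \<open>y\<close>, and \<open>y / u i\<close> is a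
        nonunit.\<close>
      define i where "i = Max A"
      have A: "finite A" "A \<noteq> {}" using p by (auto simp: A_def)
      then have "i \<in> A" unfolding i_def by (rule Max_in)
      then have i: "i \<le> M" "coeff (p i) 0 \<noteq> 0" by (auto simp: A_def)
      have i_max: "coeff (p l) 0 = 0" if "l \<le> M" "i < l" for l
        using Max_ge[OF A(1), of l] that by (fastforce simp: A_def i_def)
      have u: "u l \<in> R" "u l \<noteq> 0" if "l \<le> M" for l
        using w[of "Suc l"] that by (auto simp: u_def)
      have terms: "ev (p l) y * (u l / u i) \<in> \<mm>" if "l \<in> {..M} - {i}" for l
      proof (cases "l < i")
        case True
        then show ?thesis
          using trans[of "Suc l" "Suc i"] i(1) y m_R by (intro m_mult R_intros) (auto simp: u_def)
      next
        case False
        then have l: "l \<le> M" "i < l" using that by auto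
        obtain p' where p': "p l = pCons 0 p'"
          using i_max[OF l] by (cases "p l") auto
        have "(ev p' y * u l) * (w 0 / w (Suc i)) \<in> \<mm>"
          using trans[of 0 "Suc i"] i(1) u[OF l(1)] y m_R by (intro m_mult R_intros) auto
        then show ?thesis by (simp add: p' w0 u_def mult_ac)
      qed
      have "(\<Sum>l\<le>M. ev (p l) y * (u l / u i)) = (\<Sum>l\<le>M. ev (p l) y * u l) / u i"
        by (simp add: sum_divide_distrib)
      then have "0 = (\<Sum>l\<le>M. ev (p l) y * (u l / u i))" using sum by simp
      also have "\<dots> = ev (p i) y * (u i / u i) + (\<Sum>l\<in>{..M} - {i}. ev (p l) y * (u l / u i))"
        using i(1) by (intro sum.remove) auto
      finally have "ev (p i) y = - (\<Sum>l\<in>{..M} - {i}. ev (p l) y * (u l / u i))"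
        using u(2)[OF i(1)] by (simp add: eq_neg_iff_add_eq_0)
      moreover have "- (\<Sum>l\<in>{..M} - {i}. ev (p l) y * (u l / u i)) \<in> \<mm>"
        by (intro m_minus m_sum terms)
      ultimately have "ev (p i) y \<in> \<mm>" by (simp only:)
      then show False using ev_U[OF i(2)] by (simp add: U_def)
    qed
    then show ?thesis using that by blast
  qed
  obtain \<pi> where \<pi>: "\<pi> \<in> \<mm>" "\<pi> \<noteq> 0" and unif: "\<And>f. f \<in> \<mm> \<Longrightarrow> f / \<pi> \<in> R"
  proof -
    \<comment> \<open>Otherwise, starting at \<open>y\<close> and repeatedly choosing a nonunit not
      divisible by its predecessor gives a strict chain of any length, against
      \<open>M\<close>.\<close>
    have "\<exists>\<pi>\<in>\<mm> - {0}. \<forall>f\<in>\<mm>. f / \<pi> \<in> R"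
    proof (rule ccontr)
      assume "\<not> ?thesis"
      then obtain s where s: "\<And>\<pi>. \<pi> \<in> \<mm> - {0} \<Longrightarrow> s \<pi> \<in> \<mm> \<and> s \<pi> / \<pi> \<notin> R"
        by (simp add: Bex_def) metis
      define w where "w n = (s ^^ n) y" for n
      have w: "w n \<in> \<mm> - {0}" for n
      proof (induction n)
        case 0
        then show ?case using y by (simp add: w_def)
      next
        case (Suc n)
        have "w (Suc n) = s (w n)" by (simp add: w_def)
        then show ?case using s[OF Suc.IH] R_intros(4) by auto
      qed
      have "w n / w (Suc n) \<in> \<mm>" for n
      proof -
        have "w (Suc n) / w n \<notin> R" using s[OF w[of n]] by (simp add: w_def)
        then show ?thesis using val[of "w (Suc n) / w n"] by (simp add: \<mm>_def)
      qed
      then show False using M[of w] w m_R by (auto simp: w_def)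
    qed
    then show ?thesis using that by blast
  qed
  have \<pi>_R: "\<pi> \<in> R" "inverse \<pi> \<notin> R" using \<pi> by (auto simp: \<mm>_def)
  have "\<exists>e. y / \<pi> ^ e \<notin> R"
  proof (rule ccontr)
    assume "\<not> ?thesis"
    then have all: "y / \<pi> ^ e \<in> R" for e by blast
    \<comment> \<open>The forbidden chain \<open>y\<close>, \<open>\<pi> ^ M\<close>, ...,
      \<open>\<pi>\<close>, \<open>1\<close>. Its first step is strict because even
      \<open>\<pi> ^ Suc M\<close> divides \<open>y\<close>.\<close>
    define w where "w i = (if i = 0 then y else \<pi> ^ (Suc M - i))" for i
    have "w i / w (Suc i) \<in> \<mm>" if "i \<le> M" for i
    proof (cases "i = 0")
      case True
      have "y / \<pi> ^ Suc M * \<pi> \<in> \<mm>" by (rule m_mult[OF all \<pi>(1)])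
      then show ?thesis using True \<pi> by (simp add: w_def)
    next
      case False
      then have "Suc M - i = Suc (M - i)" using that by simp
      then show ?thesis using False \<pi> by (simp add: w_def)
    qed
    moreover have "w i \<in> R - {0}" for i
      using y m_R \<pi> \<pi>_R by (auto simp: w_def intro: R_intros)
    ultimately show False using M[of w] by (simp add: w_def)
  qed
  then obtain e where e: "y / \<pi> ^ e \<notin> R" by blast
  then have e': "\<pi> ^ e / y \<in> R" using val[of "y / \<pi> ^ e"] by simp
  have ev_power: "\<exists>r w. w \<in> U \<and> ev p y = y ^ r * w" if "p \<noteq> 0" for p
    using that
  proof (induction p)
    case 0
    then show ?case by simp
  next
    case (pCons c p)
    show ?case
    proof (cases "c = 0")
      case True
      then have "p \<noteq> 0" using pCons.prems by auto
      then obtain r w where "w \<in> U" "ev p y = y ^ r * w" using pCons.IH by blast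
      then show ?thesis using True by (intro exI[of _ "Suc r"] exI[of _ w]) simp
    next
      case False
      then show ?thesis
        using ev_U[of "pCons c p"] by (intro exI[of _ 0] exI[of _ "ev (pCons c p) y"]) simp
    qed
  qed
  \<comment> \<open>Dividing a relation between powers of \<open>f\<close> by the lowest power shows
    that \<open>f\<close> divides a nonzero polynomial in \<open>y\<close>, hence some
    \<open>y ^ r\<close>, hence \<open>\<pi> ^ (e * r)\<close>. Were \<open>f\<close> divisible by
    \<open>\<pi> ^ Suc (e * r)\<close>, then \<open>\<pi>\<close> would be a unit.\<close>
  have arch: "\<exists>N. f / \<pi> ^ N \<notin> R" if f: "f \<in> R" "f \<noteq> 0" for f
  proof (rule ccontr)
    assume "\<not> ?thesis"
    then have all: "f / \<pi> ^ N \<in> R" for N by blast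
    obtain K p where p: "\<exists>i\<le>K. p i \<noteq> 0" and sum: "(\<Sum>i\<le>K. ev (p i) y * f ^ i) = 0"
      using dependent_over_polynomials[of y] by metis
    define i where "i = (LEAST i. i \<le> K \<and> p i \<noteq> 0)"
    have i: "i \<le> K" "p i \<noteq> 0"
      using LeastI_ex[OF p] by (auto simp: i_def)
    have i_min: "p l = 0" if "l < i" for l
      using not_less_Least[of l "\<lambda>i. i \<le> K \<and> p i \<noteq> 0"] that i(1) by (auto simp: i_def)
    define z where "z l = (if l \<le> i then 0 else ev (p l) y * f ^ (l - Suc i))" for l
    have "ev (p l) y * f ^ l = f ^ i * (if l = i then ev (p i) y else 0) + f ^ i * (f * z l)"
      if "l \<le> K" for l
    proof (cases "i < l")
      case True
      then have "f ^ l = f ^ (i + Suc (l - Suc i))" by simp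
      also have "\<dots> = f ^ i * (f * f ^ (l - Suc i))" by (simp only: power_add power_Suc)
      finally show ?thesis using True by (simp add: z_def)
    qed (use i_min[of l] in \<open>auto simp: z_def\<close>)
    then have "(\<Sum>l\<le>K. ev (p l) y * f ^ l)
        = (\<Sum>l\<le>K. f ^ i * (if l = i then ev (p i) y else 0) + f ^ i * (f * z l))"
      by (intro sum.cong) auto
    also have "\<dots> = f ^ i * ev (p i) y + f ^ i * (f * (\<Sum>l\<le>K. z l))"
      using i(1) by (simp add: sum.distrib flip: sum_distrib_left)
    also have "\<dots> = f ^ i * (ev (p i) y + f * (\<Sum>l\<le>K. z l))" by (simp add: distrib_left)
    finally have evp: "ev (p i) y = f * - (\<Sum>l\<le>K. z l)"
      using sum f by (simp add: eq_neg_iff_add_eq_0)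
    obtain r w where w: "w \<in> U" "ev (p i) y = y ^ r * w" using ev_power[OF i(2)] by blast
    have "y ^ r / f = - (\<Sum>l\<le>K. z l) * inverse w"
      using w evp f by (simp add: U_iff field_simps)
    also have "\<dots> \<in> R"
      using f w y m_R by (intro R_intros) (auto simp: z_def U_iff intro!: R_intros)
    finally have "(\<pi> ^ e / y) ^ r * (y ^ r / f * (f / \<pi> ^ Suc (e * r))) \<in> R"
      using all[of "Suc (e * r)"] e' by (intro R_intros)
    also have "(\<pi> ^ e / y) ^ r * (y ^ r / f * (f / \<pi> ^ Suc (e * r))) = inverse \<pi>"
      using f y \<pi> by (simp add: power_divide power_mult field_simps)
    finally show False using \<pi>_R by simp
  qed
  have ex_R: "\<exists>n::nat. f / \<pi> ^ n \<in> U" if f: "f \<in> R" "f \<noteq> 0" for f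
  proof -
    define N where "N = (LEAST N. f / \<pi> ^ N \<notin> R)"
    have N: "f / \<pi> ^ N \<notin> R" using LeastI_ex[OF arch[OF f]] by (simp add: N_def)
    then have "N \<noteq> 0" using f by (intro notI) simp
    then obtain n where n: "N = Suc n" by (cases N) auto
    have R: "f / \<pi> ^ n \<in> R"
      using not_less_Least[of n "\<lambda>N. f / \<pi> ^ N \<notin> R"] n by (simp add: N_def)
    have "f / \<pi> ^ n \<notin> \<mm>"
      using unif[of "f / \<pi> ^ n"] N n by (auto simp: mult.commute)
    then show ?thesis using R by (auto simp: U_def)
  qed
  have ex: "\<exists>n. f / \<pi> powi n \<in> U" if f: "f \<noteq> 0" for f
  proof (cases "f \<in> R")
    case True
    then obtain n where "f / \<pi> ^ n \<in> U" using ex_R f by blast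
    then show ?thesis by (intro exI[of _ "int n"]) simp
  next
    case False
    then obtain n where "inverse f / \<pi> ^ n \<in> U" using ex_R[of "inverse f"] val[of f] f by auto
    then have "inverse (inverse f / \<pi> ^ n) \<in> U" by (rule U_inverse)
    then show ?thesis
      by (intro exI[of _ "- int n"]) (simp add: power_int_minus field_simps)
  qed
  have pow_R: "\<pi> powi n \<in> R" if "0 \<le> n" for n
    using that \<pi>_R by (simp add: power_int_def R_intros)
  have pow_m: "\<pi> powi n \<in> \<mm>" if "0 < n" for n
  proof -
    have "\<pi> powi (n - 1) * \<pi> \<in> \<mm>" using that \<pi> by (intro m_mult pow_R) auto
    then show ?thesis using \<pi> by (simp add: power_int_diff)
  qed
  have pow_split: "f / \<pi> powi n = f / \<pi> powi m * \<pi> powi (m - n)" for f n m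
    using \<pi> by (simp add: power_int_diff)
  have le: "m \<le> n" if n: "f / \<pi> powi n \<in> U" and m: "f / \<pi> powi m \<in> R" for f n m
  proof (rule ccontr)
    assume "\<not> m \<le> n"
    then have "f / \<pi> powi m * \<pi> powi (m - n) \<in> \<mm>"
      using m by (intro m_mult pow_m) auto
    then have "f / \<pi> powi n \<in> \<mm>" by (simp only: pow_split[of f n m])
    then show False using n by (simp add: U_def)
  qed
  \<comment> \<open>The exponent is unique by \<open>le\<close>; the value at \<open>0\<close> is
    the one prescribed by \<open>points\<close>.\<close>
  define v where "v f = (if f = 0 then 0 else THE n. f / \<pi> powi n \<in> U)" for f
  have v_eq: "v f = n" if n: "f / \<pi> powi n \<in> U" for f n
  proof -
    have "f \<noteq> 0" using n by (auto simp: U_iff)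
    moreover have "(THE n. f / \<pi> powi n \<in> U) = n"
      using n le by (intro the_equality antisym) (auto simp: U_def)
    ultimately show ?thesis by (simp add: v_def)
  qed
  have v_U: "f / \<pi> powi v f \<in> U" if "f \<noteq> 0" for f
    using ex[OF that] v_eq by metis
  have v_ge: "n \<le> v f \<longleftrightarrow> f / \<pi> powi n \<in> R" if f: "f \<noteq> 0" for f n
  proof
    assume "n \<le> v f"
    then have "f / \<pi> powi v f * \<pi> powi (v f - n) \<in> R"
      using v_U[OF f] by (intro R_intros pow_R) (auto simp: U_def)
    then show "f / \<pi> powi n \<in> R" by (simp only: pow_split[of f n "v f"])
  qed (use le v_U[OF f] in blast)
  have "v (f * g) = v f + v g" if "f \<noteq> 0" "g \<noteq> 0" for f g
    using U_mult[OF v_U[OF that(1)] v_U[OF that(2)]] \<pi>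
    by (intro v_eq) (simp add: power_int_add)
  moreover have "min (v f) (v g) \<le> v (f + g)" if "f \<noteq> 0" "g \<noteq> 0" "f + g \<noteq> 0" for f g
  proof -
    have "f / \<pi> powi min (v f) (v g) \<in> R" "g / \<pi> powi min (v f) (v g) \<in> R"
      using v_ge that by (metis min.cobounded1, metis min.cobounded2)
    then have "f / \<pi> powi min (v f) (v g) + g / \<pi> powi min (v f) (v g) \<in> R"
      by (rule R_intros)
    then show ?thesis using v_ge[OF that(3)] by (simp add: add_divide_distrib)
  qed
  moreover have "v (\<iota> c) = 0" if "c \<noteq> 0" for c
    using const_U[OF that] by (intro v_eq) simp
  moreover have "v \<pi> = 1"
    using \<pi> R_intros(5) by (intro v_eq) (simp add: U_iff)
  moreover have "v 0 = 0" by (simp add: v_def)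
  ultimately have "v \<in> points \<iota>"
    using \<pi>(2) unfolding points_def by blast
  moreover have "local_ring v = R"
    using v_ge[of _ 0] R_intros(4) by (auto simp: local_ring_def)
  ultimately show ?thesis by blast
qed

text \<open>If neither \<open>f\<close> nor \<open>inverse f\<close> were in \<open>R\<close>,
  maximality would put \<open>g\<close> into both \<open>R[f]\<close> and \<open>R[1/f]\<close>. Of
  two shortest polynomial expressions for \<open>g\<close>, one could then be used to shorten the
  other.\<close>

lemma maximal_subalgebra_is_valuation_ring:
  assumes R: "subalgebra R" and g: "inverse g \<in> R" "g \<notin> R"
    and maximal: "\<And>R'. subalgebra R' \<Longrightarrow> g \<notin> R' \<Longrightarrow> R \<subseteq> R' \<Longrightarrow> R' = R"
  shows "f \<in> R \<or> inverse f \<in> R"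
proof (rule ccontr)
  note R_intros = subalgebra_intros[OF R]
  assume "\<not> ?thesis"
  then have f: "f \<notin> R" "inverse f \<notin> R" by auto
  then have f0: "f \<noteq> 0" using R_intros(4) by auto
  define y where "y = inverse g"
  have g0: "g \<noteq> 0" using g R_intros(4) by auto
  have y: "y \<in> R" "y \<noteq> 0" using g g0 by (auto simp: y_def)
  \<comment> \<open>Maximality is applied to \<open>R\<close> with \<open>1/u\<close> adjoined,
    where \<open>u = 1 - y * r\<close>. That ring omits \<open>g\<close>: powers of \<open>u\<close>
    have the form \<open>1 - y * b\<close>, and \<open>u ^ n * g = a\<close> would give
    \<open>g = a + b\<close>, since \<open>y * g = 1\<close>.\<close>
  have unit: "inverse (1 - y * r) \<in> R" and nz: "1 - y * r \<noteq> 0" if r: "r \<in> R" for r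
  proof -
    define u where "u = 1 - y * r"
    show "1 - y * r \<noteq> 0"
    proof
      assume "1 - y * r = 0"
      then have "g = r" using g0 by (simp add: y_def field_simps)
      then show False using g r by simp
    qed
    then have u0: "u \<noteq> 0" by (simp add: u_def)
    have u: "u \<in> R" unfolding u_def using r y by (intro R_intros)
    define R' where "R' = {a / u ^ n | a n. a \<in> R}"
    have R'_I: "a / u ^ n \<in> R'" if "a \<in> R" for a n
      using that unfolding R'_def by blast
    have "subalgebra R'"
      unfolding subalgebra_def
    proof (intro conjI ballI)
      show "range \<iota> \<subseteq> R'" using R'_I[OF R_intros(1), of _ 0] by auto
    next
      fix h h' assume "h \<in> R'" "h' \<in> R'"
      then obtain a a' n n' where h: "h = a / u ^ n" "h' = a' / u ^ n'" "a \<in> R" "a' \<in> R"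
        unfolding R'_def by blast
      have "h + h' = (a * u ^ n' + a' * u ^ n) / u ^ (n + n')"
        using u0 by (simp add: h(1,2) add_frac_eq power_add)
      then show "h + h' \<in> R'" using h u by (auto intro!: R'_I R_intros)
      have "h * h' = (a * a') / u ^ (n + n')" using h by (simp add: power_add)
      then show "h * h' \<in> R'" using R'_I[OF R_intros(3)[OF h(3,4)]] by (simp only:)
    qed
    moreover have "g \<notin> R'"
    proof
      assume "g \<in> R'"
      then obtain a n where a: "a \<in> R" "g = a / u ^ n" unfolding R'_def by blast
      have "\<exists>b\<in>R. u ^ n = 1 - y * b"
      proof (induction n)
        case 0
        show ?case by (rule bexI[of _ 0]) (simp_all add: R_intros)
      next
        case (Suc n)
        then obtain b where b: "b \<in> R" "u ^ n = 1 - y * b" by blast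
        have "u ^ Suc n = (1 - y * r) * (1 - y * b)" by (simp add: b(2)) (simp add: u_def)
        also have "\<dots> = 1 - y * (r + b - y * r * b)" by (simp add: algebra_simps)
        finally have "u ^ Suc n = 1 - y * (r + b - y * r * b)" .
        moreover have "r + b - y * r * b \<in> R" using r b y by (intro R_intros)
        ultimately show ?case by blast
      qed
      then obtain b where b: "b \<in> R" "u ^ n = 1 - y * b" by blast
      have "u ^ n * g = a" using a u0 by simp
      moreover have "(1 - y * b) * g = g - b" using g0 by (simp add: y_def field_simps)
      ultimately have "g - b = a" using b(2) by (simp only:)
      then have "g = a + b" by (simp add: algebra_simps)
      then show False using g R_intros(2)[OF a(1) b(1)] by simp
    qed
    moreover have "R \<subseteq> R'" using R'_I[of _ 0] by auto
    ultimately have "R' = R" by (rule maximal)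
    then show "inverse (1 - y * r) \<in> R"
      using R'_I[OF R_intros(5), of 1] by (simp add: u_def inverse_eq_divide)
  qed
  define reps where "reps h n \<longleftrightarrow> (\<exists>a. (\<forall>i. a i \<in> R) \<and> g = (\<Sum>i\<le>n. a i * h ^ i))" for h n
  have reps_ex: "\<exists>n. reps h n" if h: "h \<notin> R" for h
  proof -
    define R' where "R' = {poly p h | p. \<forall>i. coeff p i \<in> R}"
    have R'_I: "poly p h \<in> R'" if "\<And>i. coeff p i \<in> R" for p
      using that unfolding R'_def by blast
    have const: "a \<in> R'" if "a \<in> R" for a
      using that R'_I[of "[:a:]"] R_intros(4) by (simp add: coeff_pCons split: nat.splits)
    have "subalgebra R'"
      unfolding subalgebra_def
    proof (intro conjI ballI)
      show "range \<iota> \<subseteq> R'" using const R_intros(1) by auto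
    next
      fix f f' assume "f \<in> R'" "f' \<in> R'"
      then obtain p p' where p: "f = poly p h" "f' = poly p' h"
        and c: "\<And>i. coeff p i \<in> R" "\<And>i. coeff p' i \<in> R"
        unfolding R'_def by blast
      show "f + f' \<in> R'" using R'_I[of "p + p'"] c by (simp add: p R_intros)
      show "f * f' \<in> R'" using R'_I[of "p * p'"] c by (simp add: p coeff_mult R_intros)
    qed
    moreover have "R \<subseteq> R'" using const by blast
    moreover have "h \<in> R'"
      using R'_I[of "[:0, 1:]"] R_intros(4,5) by (simp add: coeff_pCons split: nat.splits)
    ultimately have "g \<in> R'" using maximal h by blast
    then obtain p where "g = poly p h" "\<forall>i. coeff p i \<in> R" unfolding R'_def by blast
    then show ?thesis unfolding reps_def poly_altdef by blast
  qed
  \<comment> \<open>A relation for \<open>1/h\<close> of degree \<open>m\<close> expresses \<open>h\<^sup>m\<close> through lower powers, hence shortens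
    any relation for \<open>h\<close> of degree at least \<open>m\<close>.\<close>
  have shorten: "\<exists>n'<n. reps h n'" if h: "h \<noteq> 0" "h \<notin> R"
    and m: "reps (inverse h) m" and n: "reps h n" and "m \<le> n" for h m n
  proof -
    obtain b where b: "\<And>j. b j \<in> R" "g = (\<Sum>j\<le>m. b j * inverse h ^ j)"
      using m unfolding reps_def by blast
    obtain a where a: "\<And>i. a i \<in> R" "g = (\<Sum>i\<le>n. a i * h ^ i)"
      using n unfolding reps_def by blast
    have "n \<noteq> 0" using a g by (intro notI) auto
    \<comment> \<open>Multiplying the relation for \<open>inverse h\<close> by
      \<open>y * h ^ m\<close> leaves \<open>h ^ m\<close> on the left, because
      \<open>y * g = 1\<close>. Moving the term with \<open>b 0\<close> across produces the unit
      factor \<open>u\<close>.\<close>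
    define u where "u = 1 - y * b 0"
    have u: "u \<noteq> 0" "inverse u \<in> R" using unit nz b(1) by (auto simp: u_def)
    define c where "c i = y * b (m - i) * inverse u" for i
    have c: "c i \<in> R" for i unfolding c_def using y b u by (intro R_intros)
    have "h ^ m = h ^ m * (y * (\<Sum>j\<le>m. b j * inverse h ^ j))"
      using b(2) g0 by (simp add: y_def)
    also have "\<dots> = (\<Sum>j\<le>m. y * b j * h ^ (m - j))"
      unfolding sum_distrib_left
    proof (rule sum.cong[OF refl])
      fix j assume "j \<in> {..m}"
      then have "h ^ m = h ^ (m - j) * h ^ j" by (simp flip: power_add)
      then show "h ^ m * (y * (b j * inverse h ^ j)) = y * b j * h ^ (m - j)"
        using h by (simp add: field_simps)
    qed
    also have "\<dots> = (\<Sum>i\<le>m. y * b (m - i) * h ^ i)"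
      by (rule sum.reindex_bij_witness[of _ "\<lambda>i. m - i" "\<lambda>i. m - i"]) auto
    also have "\<dots> = (\<Sum>i<m. y * b (m - i) * h ^ i) + y * b 0 * h ^ m"
      by (simp add: lessThan_Suc_atMost[symmetric])
    finally have "u * h ^ m = (\<Sum>i<m. y * b (m - i) * h ^ i)"
      by (simp add: u_def algebra_simps)
    then have "h ^ m = inverse u * (\<Sum>i<m. y * b (m - i) * h ^ i)"
      using u by (simp add: field_simps)
    then have hm: "h ^ m = (\<Sum>i<m. c i * h ^ i)"
      by (simp add: c_def sum_distrib_left mult_ac)
    \<comment> \<open>The top term \<open>a n * h ^ n\<close> is rewritten through
      \<open>h ^ (n - m) * h ^ m\<close> and spread over the exponents from \<open>n - m\<close> to
      \<open>n - 1\<close>.\<close>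
    define a' where "a' i = a i + (if n - m \<le> i then a n * c (i - (n - m)) else 0)" for i
    have "h ^ n = h ^ (n - m) * h ^ m" using \<open>m \<le> n\<close> by (simp flip: power_add)
    also have "\<dots> = (\<Sum>i<m. c i * h ^ (i + (n - m)))"
      by (simp add: hm sum_distrib_left power_add mult_ac)
    also have "\<dots> = (\<Sum>i\<in>{n - m..<n}. c (i - (n - m)) * h ^ i)"
      using \<open>m \<le> n\<close>
      by (intro sum.reindex_bij_witness[of _ "\<lambda>i. i - (n - m)" "\<lambda>i. i + (n - m)"]) auto
    also have "\<dots> = (\<Sum>i<n. if n - m \<le> i then c (i - (n - m)) * h ^ i else 0)"
      by (rule sum.mono_neutral_cong_left) auto
    finally have hn: "h ^ n = (\<Sum>i<n. if n - m \<le> i then c (i - (n - m)) * h ^ i else 0)" .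
    have "g = (\<Sum>i<n. a i * h ^ i) + a n * h ^ n"
      using a(2) by (simp add: lessThan_Suc_atMost[symmetric])
    also have "\<dots> = (\<Sum>i<n. a' i * h ^ i)"
      unfolding hn sum_distrib_left sum.distrib[symmetric]
      by (rule sum.cong) (auto simp: a'_def algebra_simps)
    also have "{..<n} = {..n - 1}" using \<open>n \<noteq> 0\<close> by auto
    finally have "reps h (n - 1)"
      unfolding reps_def using a(1) c by (intro exI[of _ a']) (auto simp: a'_def intro: R_intros)
    then show ?thesis using \<open>n \<noteq> 0\<close> by (intro exI[of _ "n - 1"]) auto
  qed
  \<comment> \<open>With both degrees minimal, the expression whose degree is at least that of the
    other can still be shortened.\<close>
  define n where "n = (LEAST n. reps f n)"
  define m where "m = (LEAST m. reps (inverse f) m)"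
  have n: "reps f n" and m: "reps (inverse f) m"
    using LeastI_ex[OF reps_ex] f by (auto simp: n_def m_def)
  have "\<not> reps f n'" if "n' < n" for n'
    using not_less_Least[of n' "reps f"] that by (simp add: n_def)
  moreover have "\<not> reps (inverse f) n'" if "n' < m" for n'
    using not_less_Least[of n' "reps (inverse f)"] that by (simp add: m_def)
  ultimately show False
    using shorten[of f m n] shorten[of "inverse f" n m] n m f f0 by (cases "m \<le> n") auto
qed

subsection \<open>Points\<close>

text \<open>The fractional ideals of the local ring. The explicit \<open>0\<close> is there because
  the value \<open>0\<close> at \<open>0\<close> stands for infinity.\<close>

definition val_ge :: "('f \<Rightarrow> int) \<Rightarrow> int \<Rightarrow> 'f set" where
  "val_ge v n = {f. f = 0 \<or> n \<le> v f}"

lemma local_ring_eq_val_ge: "local_ring v = val_ge v 0"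
  by (auto simp: local_ring_def val_ge_def)

lemma max_ideal_eq_val_ge: "max_ideal v = val_ge v 1"
  by (auto simp: max_ideal_def val_ge_def)

context
  fixes v
  assumes v: "v \<in> points \<iota>"
begin

lemma val_mult: "f \<noteq> 0 \<Longrightarrow> g \<noteq> 0 \<Longrightarrow> v (f * g) = v f + v g"
  and val_add: "f \<noteq> 0 \<Longrightarrow> g \<noteq> 0 \<Longrightarrow> f + g \<noteq> 0 \<Longrightarrow> min (v f) (v g) \<le> v (f + g)"
  and val_const: "v (\<iota> c) = 0"
  using v by (auto simp: points_def) (cases "c = 0"; simp)

lemma val_1: "v 1 = 0"
  using val_const[of 1] by (simp add: emb_one)

lemma val_inverse: "f \<noteq> 0 \<Longrightarrow> v (inverse f) = - v f"
  using val_mult[of f "inverse f"] val_1 by simp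

lemma val_minus: "v (- f) = v f"
proof (cases "f = 0")
  case False
  then show ?thesis
    using val_mult[of "\<iota> (- 1)" f] val_const[of "- 1"] by (simp add: emb_minus emb_one)
qed simp

lemma val_power: "f \<noteq> 0 \<Longrightarrow> v (f ^ n) = int n * v f"
  by (induction n) (simp_all add: val_1 val_mult algebra_simps)

lemma ex_val_eq: "\<exists>h. h \<noteq> 0 \<and> v h = n"
proof -
  obtain t where t: "t \<noteq> 0" "v t = 1" using v by (auto simp: points_def)
  show ?thesis
  proof (cases "0 \<le> n")
    case True
    then show ?thesis using t by (intro exI[of _ "t ^ nat n"]) (simp add: val_power)
  next
    case False
    then show ?thesis
      using t by (intro exI[of _ "inverse (t ^ nat (- n))"]) (simp add: val_inverse val_power)
  qed
qed

lemma val_ge_0: "0 \<in> val_ge v n"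
  by (simp add: val_ge_def)

lemma val_ge_add: "f \<in> val_ge v n \<Longrightarrow> g \<in> val_ge v n \<Longrightarrow> f + g \<in> val_ge v n"
  using val_add[of f g] by (fastforce simp: val_ge_def)

lemma val_ge_mult: "f \<in> val_ge v m \<Longrightarrow> g \<in> val_ge v n \<Longrightarrow> f * g \<in> val_ge v (m + n)"
  by (cases "f = 0"; cases "g = 0") (simp_all add: val_ge_def val_mult)

lemma val_ge_const: "\<iota> c \<in> val_ge v 0"
  by (simp add: val_ge_def val_const)

lemma val_ge_scale: "f \<in> val_ge v n \<Longrightarrow> \<iota> c * f \<in> val_ge v n"
  using val_ge_mult[OF val_ge_const] by simp

lemma val_ge_minus: "f \<in> val_ge v n \<Longrightarrow> - f \<in> val_ge v n"
  by (auto simp: val_ge_def val_minus)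

lemma val_ge_diff: "f \<in> val_ge v n \<Longrightarrow> g \<in> val_ge v n \<Longrightarrow> f - g \<in> val_ge v n"
  using val_ge_add[OF _ val_ge_minus] by simp

lemma val_ge_sum: "(\<And>i. i \<in> I \<Longrightarrow> h i \<in> val_ge v n) \<Longrightarrow> sum h I \<in> val_ge v n"
  by (induction I rule: infinite_finite_induct) (auto intro: val_ge_0 val_ge_add)

lemma val_ge_mult_iff: "h \<noteq> 0 \<Longrightarrow> h * f \<in> val_ge v (v h + n) \<longleftrightarrow> f \<in> val_ge v n"
  by (cases "f = 0") (simp_all add: val_ge_def val_mult)

lemma subalgebra_val_ge_0: "subalgebra (val_ge v 0)"
  using val_ge_const val_ge_add[of _ 0] val_ge_mult[of _ 0 _ 0] by (auto simp: subalgebra_def)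

text \<open>Residues independent over \<open>k\<close> number at most \<open>M\<close>, the bound
  for relations over \<open>k[t]\<close> with \<open>t\<close> a uniformiser. A largest independent
  family spans the residue field, and its combinations over the finite field \<open>k\<close> form
  \<open>T\<close>.\<close>

lemma residue_field_finite:
  "\<exists>T. finite T \<and> (\<forall>f\<in>val_ge v 0. \<exists>\<tau>\<in>T. f - \<tau> \<in> val_ge v 1)"
proof -
  obtain t where t: "t \<noteq> 0" "v t = 1" using v by (auto simp: points_def)
  then have t_in: "t \<in> val_ge v 1" "t \<in> val_ge v 0" by (auto simp: val_ge_def)
  obtain M where M: "\<And>u :: nat \<Rightarrow> 'f. \<exists>p. (\<exists>i\<le>M. coeff (p i) 0 \<noteq> 0) \<and> (\<Sum>i\<le>M. ev (p i) t * u i) = 0"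
    using dependent_over_polynomials_normalised[OF t(1)] by blast
  define indep where "indep m \<longleftrightarrow> (\<exists>u. (\<forall>i. u i \<in> val_ge v 0) \<and>
    (\<forall>c. (\<Sum>i<m. \<iota> (c i) * u i) \<in> val_ge v 1 \<longrightarrow> (\<forall>i<m. c i = 0)))" for m :: nat
  have "indep 0" by (auto simp: indep_def intro: exI[of _ "\<lambda>_. 0"] val_ge_0)
  moreover have "m \<le> M" if "indep m" for m
  proof (rule ccontr)
    assume "\<not> m \<le> M"
    obtain u where u: "\<And>i. u i \<in> val_ge v 0"
      and ind: "\<And>c i. (\<Sum>i<m. \<iota> (c i) * u i) \<in> val_ge v 1 \<Longrightarrow> i < m \<Longrightarrow> c i = 0"
      using \<open>indep m\<close> unfolding indep_def by blast
    obtain p where p: "\<exists>i\<le>M. coeff (p i) 0 \<noteq> 0" "(\<Sum>i\<le>M. ev (p i) t * u i) = 0"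
      using M by blast
    define c where "c i = (if i \<le> M then coeff (p i) 0 else 0)" for i
    \<comment> \<open>As \<open>t\<close> has residue \<open>0\<close>, each polynomial reduces to
      its constant coefficient, and the relation to a nontrivial one over \<open>k\<close>.\<close>
    have "\<iota> (coeff (p i) 0) * u i - ev (p i) t * u i \<in> val_ge v 1" for i
    proof -
      obtain a p' where p': "p i = pCons a p'" by (cases "p i")
      have "- (t * ev p' t * u i) \<in> val_ge v (1 + 0 + 0)"
        using t_in u subalgebra_ev[OF subalgebra_val_ge_0] by (intro val_ge_minus val_ge_mult)
      then show ?thesis by (simp add: p' algebra_simps)
    qed
    then have "(\<Sum>i\<le>M. \<iota> (coeff (p i) 0) * u i - ev (p i) t * u i) \<in> val_ge v 1"
      by (rule val_ge_sum)
    also have "(\<Sum>i\<le>M. \<iota> (coeff (p i) 0) * u i - ev (p i) t * u i) = (\<Sum>i\<le>M. \<iota> (c i) * u i)"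
      using p(2) by (simp add: sum_subtractf c_def)
    also have "\<dots> = (\<Sum>i<m. \<iota> (c i) * u i)"
      using \<open>\<not> m \<le> M\<close> by (intro sum.mono_neutral_left) (auto simp: c_def)
    finally have "c i = 0" if "i < m" for i using ind that by blast
    moreover obtain i where "i \<le> M" "coeff (p i) 0 \<noteq> 0" using p(1) by blast
    moreover have "c i = coeff (p i) 0" "i < m"
      using \<open>i \<le> M\<close> \<open>\<not> m \<le> M\<close> by (simp_all add: c_def)
    ultimately show False by simp
  qed
  ultimately obtain m where m: "indep m" "\<And>m'. indep m' \<Longrightarrow> m' \<le> m"
    using GreatestI_nat[of indep 0 M] Greatest_le_nat[of indep _ M] by blast
  obtain u where u: "\<And>i. u i \<in> val_ge v 0"
    and ind: "\<And>c i. (\<Sum>i<m. \<iota> (c i) * u i) \<in> val_ge v 1 \<Longrightarrow> i < m \<Longrightarrow> c i = 0"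
    using m(1) unfolding indep_def by blast
  define T where "T = (\<lambda>c. \<Sum>i<m. \<iota> (c i) * u i) ` (PiE {..<m} (\<lambda>_. UNIV))"
  have "finite T" unfolding T_def by (intro finite_imageI finite_PiE) auto
  moreover have "\<exists>\<tau>\<in>T. f - \<tau> \<in> val_ge v 1" if f: "f \<in> val_ge v 0" for f
  proof -
    define u' where "u' = u(m := f)"
    have "\<not> indep (Suc m)" using m(2)[of "Suc m"] by auto
    moreover have "\<forall>i. u' i \<in> val_ge v 0" using u f by (simp add: u'_def)
    ultimately obtain c where c: "(\<Sum>i<Suc m. \<iota> (c i) * u' i) \<in> val_ge v 1" "\<exists>i<Suc m. c i \<noteq> 0"
      unfolding indep_def by blast
    have c_sum: "(\<Sum>i<Suc m. \<iota> (c i) * u' i) = (\<Sum>i<m. \<iota> (c i) * u i) + \<iota> (c m) * f"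
      by (simp add: u'_def)
    have cm: "c m \<noteq> 0"
    proof
      assume "c m = 0"
      then have "c i = 0" if "i < m" for i using c(1) c_sum ind[of c i] that by simp
      then show False using c(2) \<open>c m = 0\<close> by (auto simp: less_Suc_eq)
    qed
    define c' where "c' = restrict (\<lambda>i. - (inverse (c m) * c i)) {..<m}"
    have "f - (\<Sum>i<m. \<iota> (c' i) * u i) = \<iota> (inverse (c m)) * (\<Sum>i<Suc m. \<iota> (c i) * u' i)"
    proof -
      have "\<iota> (inverse (c m)) * (\<iota> (c m) * f) = f"
        using emb_inverse[OF cm] by (simp flip: mult.assoc)
      moreover have "(\<Sum>i<m. \<iota> (c' i) * u i) = - (\<iota> (inverse (c m)) * (\<Sum>i<m. \<iota> (c i) * u i))"
        by (simp add: c'_def emb_minus emb_mult sum_negf sum_distrib_left mult.assoc)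
      ultimately show ?thesis unfolding c_sum by (simp add: distrib_left)
    qed
    also have "\<dots> \<in> val_ge v 1" using c(1) by (rule val_ge_scale)
    finally have "f - (\<Sum>i<m. \<iota> (c' i) * u i) \<in> val_ge v 1" .
    moreover have "(\<Sum>i<m. \<iota> (c' i) * u i) \<in> T"
      unfolding T_def by (rule imageI) (simp add: c'_def PiE_def extensional_def)
    ultimately show ?thesis by blast
  qed
  ultimately show ?thesis by blast
qed

end

text \<open>Zorn's lemma gives a maximal subalgebra containing \<open>1/g\<close> but not
  \<open>g\<close>. It is the local ring of a point, and \<open>g\<close> has a pole there because
  it lies outside.\<close>

lemma exists_pole:
  assumes Q: "Q \<in> points \<iota>" and g: "0 < Q g"
  shows "\<exists>v\<in>points \<iota>. v g < 0"
proof -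
  have g0: "g \<noteq> 0" using g Q by (auto simp: points_def)
  define y where "y = inverse g"
  have Qy: "Q y < 0" and y0: "y \<noteq> 0" using g g0 val_inverse[OF Q] by (auto simp: y_def)
  define \<A> where "\<A> = {R. subalgebra R \<and> y \<in> R \<and> g \<notin> R}"
  have "range (\<lambda>p. ev p y) \<in> \<A>"
  proof -
    \<comment> \<open>Since \<open>y\<close> has a pole at \<open>Q\<close>, every element of
      \<open>k[y]\<close> is constant or has a pole there. Having a zero at \<open>Q\<close>,
      \<open>g\<close> is neither, so \<open>k[y]\<close> can start the Zorn argument.\<close>
    have pole: "(\<exists>c. ev p y = \<iota> c) \<or> (ev p y \<noteq> 0 \<and> Q (ev p y) < 0)" for p
    proof (induction p)
      case 0
      then show ?case by (auto intro: exI[of _ 0])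
    next
      case (pCons c p)
      show ?case
      proof (cases "ev p y = 0")
        case True
        then show ?thesis by auto
      next
        case False
        have neg: "Q (y * ev p y) < 0"
          using pCons.IH False Qy y0 val_const[OF Q] by (auto simp: val_mult[OF Q])
        have "y * ev p y \<notin> val_ge Q 0" using neg False y0 by (simp add: val_ge_def)
        then have "ev (pCons c p) y \<notin> val_ge Q 0"
          using val_ge_diff[OF Q _ val_ge_const[OF Q, of c], of "ev (pCons c p) y"] by auto
        then show ?thesis by (auto simp: val_ge_def)
      qed
    qed
    have "subalgebra (range (\<lambda>p. ev p y))"
      unfolding subalgebra_def
    proof (intro conjI ballI)
      show "range \<iota> \<subseteq> range (\<lambda>p. ev p y)"
      proof
        fix f assume "f \<in> range \<iota>"
        then obtain c where "f = ev [:c:] y" by auto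
        then show "f \<in> range (\<lambda>p. ev p y)" by blast
      qed
    qed (auto simp flip: ev_add ev_mult)
    moreover have "y = ev [:0, 1:] y" by (simp add: emb_one)
    then have "y \<in> range (\<lambda>p. ev p y)" by blast
    moreover have "g \<notin> range (\<lambda>p. ev p y)"
    proof
      assume "g \<in> range (\<lambda>p. ev p y)"
      then obtain p where "g = ev p y" by blast
      then show False using pole[of p] g val_const[OF Q] by auto
    qed
    ultimately show ?thesis by (simp add: \<A>_def)
  qed
  moreover have "\<Union>\<C> \<in> \<A>" if "\<C> \<noteq> {}" and chain: "subset.chain \<A> \<C>" for \<C>
  proof -
    have sub: "\<C> \<subseteq> \<A>" and lin: "\<And>X Y. X \<in> \<C> \<Longrightarrow> Y \<in> \<C> \<Longrightarrow> X \<subseteq> Y \<or> Y \<subseteq> X"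
      using chain by (auto simp: subset_chain_def)
    have "f + f' \<in> \<Union>\<C>" "f * f' \<in> \<Union>\<C>" if "f \<in> \<Union>\<C>" "f' \<in> \<Union>\<C>" for f f'
    proof -
      obtain X where X: "X \<in> \<C>" "f \<in> X" "f' \<in> X" using \<open>f \<in> \<Union>\<C>\<close> \<open>f' \<in> \<Union>\<C>\<close> lin by blast
      then have "subalgebra X" using sub by (auto simp: \<A>_def)
      then show "f + f' \<in> \<Union>\<C>" "f * f' \<in> \<Union>\<C>"
        using X by (auto intro: subalgebra_add subalgebra_mult)
    qed
    moreover have "range \<iota> \<subseteq> \<Union>\<C>" "y \<in> \<Union>\<C>" "g \<notin> \<Union>\<C>"
      using sub \<open>\<C> \<noteq> {}\<close> by (fastforce simp: \<A>_def subalgebra_def)+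
    ultimately show ?thesis by (auto simp: \<A>_def subalgebra_def simp del: Union_iff)
  qed
  ultimately obtain R where R: "R \<in> \<A>" and max: "\<And>X. X \<in> \<A> \<Longrightarrow> R \<subseteq> X \<Longrightarrow> X = R"
    using subset_Zorn_nonempty[of \<A>] by blast
  have sub: "subalgebra R" "inverse g \<in> R" "g \<notin> R" using R by (auto simp: \<A>_def y_def)
  have "f \<in> R \<or> inverse f \<in> R" for f
    using sub
  proof (rule maximal_subalgebra_is_valuation_ring)
    show "R' = R" if "subalgebra R'" "g \<notin> R'" "R \<subseteq> R'" for R'
      using that sub by (intro max) (auto simp: \<A>_def y_def)
  qed
  then obtain v where "v \<in> points \<iota>" "local_ring v = R"
    using valuation_ring_is_local_ring_of_point[OF sub(1)] sub(3) by blast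
  then show ?thesis using sub(3) by (force simp: local_ring_def)
qed

subsection \<open>Riemann-Roch spaces\<close>

text \<open>An intersection of fractional ideals, so closure properties can be checked point by
  point.\<close>

lemma RR_space_altdef: "RR_space \<iota> E = {f. \<forall>v\<in>points \<iota>. f \<in> val_ge v (- Poly_Mapping.lookup E v)}"
  by (auto simp: RR_space_def val_ge_def algebra_simps)

lemma RR_space_0: "0 \<in> RR_space \<iota> E"
  by (simp add: RR_space_def)

lemma RR_space_add: "f \<in> RR_space \<iota> E \<Longrightarrow> g \<in> RR_space \<iota> E \<Longrightarrow> f + g \<in> RR_space \<iota> E"
  by (simp add: RR_space_altdef val_ge_add)

lemma RR_space_diff: "f \<in> RR_space \<iota> E \<Longrightarrow> g \<in> RR_space \<iota> E \<Longrightarrow> f - g \<in> RR_space \<iota> E"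
  by (simp add: RR_space_altdef val_ge_diff)

lemma RR_space_scale: "f \<in> RR_space \<iota> E \<Longrightarrow> \<iota> c * f \<in> RR_space \<iota> E"
  by (simp add: RR_space_altdef val_ge_scale)

lemma RR_space_mono:
  assumes "\<And>v. v \<in> points \<iota> \<Longrightarrow> Poly_Mapping.lookup E v \<le> Poly_Mapping.lookup E' v"
  shows "RR_space \<iota> E \<subseteq> RR_space \<iota> E'"
proof
  fix f assume f: "f \<in> RR_space \<iota> E"
  have "0 \<le> v f + Poly_Mapping.lookup E' v" if "v \<in> points \<iota>" "f \<noteq> 0" for v
  proof -
    have "0 \<le> v f + Poly_Mapping.lookup E v" using f that by (simp add: RR_space_def)
    then show ?thesis using assms[OF that(1)] by linarith
  qed
  then show "f \<in> RR_space \<iota> E'" by (auto simp: RR_space_def)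
qed

lemma RR_space_minus_point:
  assumes "v \<in> points \<iota>"
  shows "RR_space \<iota> (E - frag_of v) =
    RR_space \<iota> E \<inter> val_ge v (1 - Poly_Mapping.lookup E v)"
proof -
  have "f \<in> RR_space \<iota> (E - frag_of v) \<longleftrightarrow>
      f \<in> RR_space \<iota> E \<and> f \<in> val_ge v (1 - Poly_Mapping.lookup E v)" for f
  proof (cases "f = 0")
    case False
    have "(\<forall>w\<in>points \<iota>. 0 \<le> w f + (Poly_Mapping.lookup E w - (if w = v then 1 else 0))) \<longleftrightarrow>
        (\<forall>w\<in>points \<iota>. 0 \<le> w f + Poly_Mapping.lookup E w) \<and> 1 - Poly_Mapping.lookup E v \<le> v f"
        (is "(\<forall>w\<in>_. ?l w) \<longleftrightarrow> (\<forall>w\<in>_. ?r w) \<and> ?s")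
    proof -
      have "?l w \<longleftrightarrow> ?r w \<and> (w = v \<longrightarrow> ?s)" for w by (cases "w = v") auto
      then show ?thesis using assms by blast
    qed
    then show ?thesis using False by (simp add: RR_space_def val_ge_def lookup_minus)
  qed (simp add: RR_space_0 val_ge_def)
  then show ?thesis by blast
qed

text \<open>A function without poles is constant: subtracting its value at the rational point
  \<open>Q\<close>, which lies in \<open>k\<close>, leaves a function with a zero and no pole, hence
  \<open>0\<close>.\<close>

lemma finite_RR_space_zero:
  assumes Q: "Q \<in> rational_points \<iota>"
  shows "finite (RR_space \<iota> 0)"
proof -
  have Qp: "Q \<in> points \<iota>" using Q by (simp add: rational_points_def)
  have "RR_space \<iota> 0 \<subseteq> range \<iota>"
  proof
    fix f assume f: "f \<in> RR_space \<iota> 0"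
    then have "f \<in> local_ring Q" using Qp by (auto simp: RR_space_def local_ring_def)
    then obtain c where c: "f - \<iota> c \<in> max_ideal Q" using Q by (auto simp: rational_points_def)
    have "\<iota> c \<in> RR_space \<iota> 0" by (simp add: RR_space_altdef val_ge_const)
    then have "f - \<iota> c \<in> RR_space \<iota> 0" using f by (intro RR_space_diff)
    then have "f - \<iota> c = 0"
      using c exists_pole[OF Qp, of "f - \<iota> c"] by (force simp: max_ideal_def RR_space_def)
    then show "f \<in> range \<iota>" by auto
  qed
  then show ?thesis by (rule finite_subset) simp
qed

text \<open>Multiplication by \<open>h\<close> moves the leading term at \<open>v\<close> into the
  residue field. Functions with the same residue differ by an element of
  \<open>RR_space \<iota> E\<close>, and there are finitely many residues.\<close>

lemma finite_RR_space_plus_point: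
  assumes v: "v \<in> points \<iota>" and fin: "finite (RR_space \<iota> E)"
  shows "finite (RR_space \<iota> (E + frag_of v))"
proof -
  define n where "n = Poly_Mapping.lookup E v + 1"
  obtain h where h: "h \<noteq> 0" "v h = n" using ex_val_eq[OF v] by blast
  obtain T where T: "finite T" "\<And>f. f \<in> val_ge v 0 \<Longrightarrow> \<exists>\<tau>\<in>T. f - \<tau> \<in> val_ge v 1"
    using residue_field_finite[OF v] by blast
  define V where "V \<tau> = {f \<in> RR_space \<iota> (E + frag_of v). h * f - \<tau> \<in> val_ge v 1}" for \<tau>
  have E: "RR_space \<iota> E = RR_space \<iota> (E + frag_of v) \<inter> val_ge v (1 - n)"
    using RR_space_minus_point[OF v, of "E + frag_of v"]
    by (simp add: lookup_add n_def)
  have "RR_space \<iota> (E + frag_of v) \<subseteq> (\<Union>\<tau>\<in>T. V \<tau>)"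
  proof
    fix f assume f: "f \<in> RR_space \<iota> (E + frag_of v)"
    then have "f \<in> val_ge v (- n)"
      using v by (auto simp: RR_space_altdef lookup_add n_def)
    then have "h * f \<in> val_ge v 0" using val_ge_mult_iff[OF v h(1), of f "- n"] h by simp
    then show "f \<in> (\<Union>\<tau>\<in>T. V \<tau>)" using T f by (auto simp: V_def)
  qed
  moreover have "finite (V \<tau>)" for \<tau>
  proof (cases "V \<tau> = {}")
    case False
    then obtain f where f: "f \<in> V \<tau>" by blast
    have "V \<tau> \<subseteq> (\<lambda>g. g + f) ` RR_space \<iota> E"
    proof
      fix f' assume f': "f' \<in> V \<tau>"
      have "(h * f' - \<tau>) - (h * f - \<tau>) \<in> val_ge v 1"
        using f f' by (intro val_ge_diff[OF v, of "h * f' - \<tau>"]) (simp_all add: V_def)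
      then have "h * (f' - f) \<in> val_ge v 1" by (simp add: algebra_simps)
      then have "f' - f \<in> val_ge v (1 - n)"
        using val_ge_mult_iff[OF v h(1), of _ "1 - n"] h by simp
      moreover have "f' - f \<in> RR_space \<iota> (E + frag_of v)"
        using f f' by (intro RR_space_diff) (auto simp: V_def)
      ultimately have "f' - f \<in> RR_space \<iota> E" using E by blast
      then show "f' \<in> (\<lambda>g. g + f) ` RR_space \<iota> E" by (rule rev_image_eqI) simp
    qed
    then show ?thesis using fin by (rule finite_subset[OF _ finite_imageI])
  qed simp
  ultimately show ?thesis using T(1) by (meson finite_UN_I finite_subset)
qed

text \<open>The induction carries finiteness from an arbitrary \<open>E\<close> to
  \<open>E + A\<close> and \<open>E - A\<close>, so that the case of a difference follows by
  composing two such transfers.\<close>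

lemma finite_RR_space:
  assumes Q: "Q \<in> rational_points \<iota>" and A: "A \<in> divisors \<iota>"
  shows "finite (RR_space \<iota> A)"
proof -
  have "Poly_Mapping.keys A \<subseteq> points \<iota>" using A by simp
  then have "\<forall>E. finite (RR_space \<iota> E) \<longrightarrow>
      finite (RR_space \<iota> (E + A)) \<and> finite (RR_space \<iota> (E - A))"
  proof (induction A rule: frag_induction)
    case zero
    show ?case by simp
  next
    case (one v)
    then show ?case
      using finite_RR_space_plus_point RR_space_minus_point by simp
  next
    case (diff A A')
    then show ?case by (simp add: add_diff_eq) (simp add: diff_diff_eq2 diff_add_eq)
  qed
  then show ?thesis using finite_RR_space_zero[OF Q] by force
qed

text \<open>On the finite space \<open>RR_space \<iota> A\<close> the values at \<open>v\<close> are
  bounded, so a sufficiently high prescribed zero at \<open>v\<close> leaves only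
  \<open>0\<close>.\<close>

lemma eventually_RR_space_trivial:
  assumes Q: "Q \<in> rational_points \<iota>" and A: "A \<in> divisors \<iota>" and v: "v \<in> points \<iota>"
  shows "\<exists>n0. \<forall>n\<le>n0. RR_space \<iota> (A + frag_cmul n (frag_of v)) = {0}"
proof -
  define m where "m = Max (insert 0 (v ` RR_space \<iota> A))"
  have m: "0 \<le> m" "\<And>f. f \<in> RR_space \<iota> A \<Longrightarrow> v f \<le> m"
    using finite_RR_space[OF Q A] by (auto simp: m_def)
  have "RR_space \<iota> (A + frag_cmul n (frag_of v)) = {0}"
    if n: "n \<le> - (m + 1 + \<bar>Poly_Mapping.lookup A v\<bar>)" for n
  proof -
    have "f = 0" if f: "f \<in> RR_space \<iota> (A + frag_cmul n (frag_of v))" for f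
    proof (rule ccontr)
      assume "f \<noteq> 0"
      then have "0 \<le> v f + (Poly_Mapping.lookup A v + n)"
        using f v by (auto simp: RR_space_def lookup_add)
      moreover have "f \<in> RR_space \<iota> A"
        using f RR_space_mono[of "A + frag_cmul n (frag_of v)" A] n m(1)
        by (force simp: lookup_add)
      ultimately show False using m(2)[of f] n by linarith
    qed
    then show ?thesis using RR_space_0 by blast
  qed
  then show ?thesis by blast
qed

section \<open>Discrepancies and linear equivalence\<close>

lemma RR_space_class:
  assumes p: "p \<in> principal_divisors \<iota>"
  obtains h where "h \<noteq> 0" "\<And>E. RR_space \<iota> (p + E) = {f. h * f \<in> RR_space \<iota> E}"
proof -
  obtain h where h: "h \<noteq> 0" "\<And>v. v \<in> points \<iota> \<Longrightarrow> Poly_Mapping.lookup p v = v h"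
    using p by (auto simp: principal_divisors_def)
  have "RR_space \<iota> (p + E) = {f. h * f \<in> RR_space \<iota> E}" for E
    using h val_mult by (fastforce simp: RR_space_def lookup_add algebra_simps)
  then show ?thesis using h(1) that by blast
qed

lemma zero_principal: "0 \<in> principal_divisors \<iota>"
  using val_1 by (auto simp: principal_divisors_def intro!: exI[of _ 1])

text \<open>Membership does not depend on the representative: adding a principal divisor replaces
  all four spaces by their preimages under multiplication by the same nonzero \<open>h\<close>,
  which preserves equality and inequality.\<close>

lemma divisor_class_in_discrepancies_iff:
  assumes A: "A \<in> divisors \<iota>"
  shows "divisor_class \<iota> A \<in> discrepancies \<iota> P Q \<longleftrightarrow>
    RR_space \<iota> A \<noteq> RR_space \<iota> (A - frag_of P) \<and>
    RR_space \<iota> (A - frag_of Q) = RR_space \<iota> (A - frag_of Q - frag_of P)"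
    (is "?L \<longleftrightarrow> ?R")
proof
  assume ?L
  then obtain A' where A': "divisor_class \<iota> A = divisor_class \<iota> A'"
      "RR_space \<iota> A' \<noteq> RR_space \<iota> (A' - frag_of P)"
      "RR_space \<iota> (A' - frag_of Q) = RR_space \<iota> (A' - frag_of Q - frag_of P)"
    unfolding discrepancies_def by blast
  have "A \<in> divisor_class \<iota> A"
    using zero_principal by (force simp: divisor_class_def r_coset_def)
  then obtain p where p: "p \<in> principal_divisors \<iota>" "A = p + A'"
    unfolding A'(1) by (auto simp: divisor_class_def r_coset_def)
  obtain h where h: "h \<noteq> 0" "\<And>E. RR_space \<iota> (p + E) = {f. h * f \<in> RR_space \<iota> E}"
    using RR_space_class[OF p(1)] by blast
  have inj: "{f. h * f \<in> X} = {f. h * f \<in> Y} \<longleftrightarrow> X = Y" for X Y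
  proof
    assume eq: "{f. h * f \<in> X} = {f. h * f \<in> Y}"
    have "f \<in> X \<longleftrightarrow> f \<in> Y" for f
      using eq[THEN eqset_imp_iff, of "f / h"] h(1) by simp
    then show "X = Y" by blast
  qed simp
  show ?R using A' h(2) inj by (simp add: p(2) flip: add_diff_eq)
next
  assume ?R
  then show ?L unfolding discrepancies_def using A by blast
qed

section \<open>Dimension growth at a rational point\<close>

text \<open>The function \<open>g\<close> has the least order at \<open>P\<close> allowed by
  \<open>E\<close>, so \<open>f / g\<close> is regular at \<open>P\<close>. By rationality its value
  there is some \<open>c\<close> in \<open>k\<close>, and \<open>f - \<iota> c * g\<close> vanishes
  to higher order.\<close>

lemma RR_space_codim_le_1:
  assumes P: "P \<in> rational_points \<iota>"
    and f: "f \<in> RR_space \<iota> E" and g: "g \<in> RR_space \<iota> E" "g \<notin> RR_space \<iota> (E - frag_of P)"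
  shows "\<exists>c. f - \<iota> c * g \<in> RR_space \<iota> (E - frag_of P)"
proof -
  have Pp: "P \<in> points \<iota>" using P by (simp add: rational_points_def)
  note minus = RR_space_minus_point[OF Pp, of E]
  have g0: "g \<noteq> 0" using g RR_space_0 by blast
  have Pg: "P g = - Poly_Mapping.lookup E P"
    using g g0 Pp unfolding minus by (auto simp: RR_space_altdef val_ge_def)
  have "g * (f / g) \<in> val_ge P (P g + 0)"
    using f g0 Pg Pp by (auto simp: RR_space_altdef)
  then have "f / g \<in> local_ring P"
    using val_ge_mult_iff[OF Pp g0] by (simp only: local_ring_eq_val_ge)
  then obtain c where c: "f / g - \<iota> c \<in> max_ideal P" using P by (auto simp: rational_points_def)
  then have "g * (f / g - \<iota> c) \<in> val_ge P (P g + 1)"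
    using val_ge_mult_iff[OF Pp g0] by (simp add: max_ideal_eq_val_ge)
  then have "f - \<iota> c * g \<in> val_ge P (1 - Poly_Mapping.lookup E P)"
    using g0 Pg by (simp add: algebra_simps)
  moreover have "f - \<iota> c * g \<in> RR_space \<iota> E" using f g by (intro RR_space_diff RR_space_scale)
  ultimately show ?thesis unfolding minus by blast
qed

sublocale VS: vector_space "const_scale \<iota>"
  by (rule vector_space_const_scale)

lemma RR_space_subspace: "VS.subspace (RR_space \<iota> E)"
  by (auto simp: VS.subspace_def const_scale_def intro: RR_space_0 RR_space_add RR_space_scale)

text \<open>At a jump, a basis of the smaller space together with one new function \<open>g\<close>
  is a basis of the larger one.\<close>

lemma dim_RR_space_step:
  assumes P: "P \<in> rational_points \<iota>" and fin: "finite (RR_space \<iota> (E - frag_of P))"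
  shows "VS.dim (RR_space \<iota> E) = VS.dim (RR_space \<iota> (E - frag_of P)) +
    (if RR_space \<iota> E \<noteq> RR_space \<iota> (E - frag_of P) then 1 else 0)"
proof (cases "RR_space \<iota> E = RR_space \<iota> (E - frag_of P)")
  case False
  let ?W = "RR_space \<iota> (E - frag_of P)"
  have sub: "?W \<subseteq> RR_space \<iota> E"
    by (rule RR_space_mono) (simp add: lookup_minus)
  then obtain g where g: "g \<in> RR_space \<iota> E" "g \<notin> ?W" using False by blast
  obtain S where S: "S \<subseteq> ?W" "VS.independent S" "?W \<subseteq> VS.span S" "card S = VS.dim ?W"
    using VS.basis_exists by blast
  have span: "VS.span S = ?W"
    using S RR_space_subspace by (intro antisym VS.span_minimal)
  have "g \<notin> S" using g S by blast
  have "RR_space \<iota> E \<subseteq> VS.span (insert g S)"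
  proof
    fix f assume "f \<in> RR_space \<iota> E"
    then obtain c where "f - \<iota> c * g \<in> ?W" using RR_space_codim_le_1[OF P] g by blast
    then show "f \<in> VS.span (insert g S)"
      unfolding VS.span_insert span const_scale_def by blast
  qed
  moreover have "VS.independent (insert g S)"
    using S g span by (simp add: VS.independent_insert)
  moreover have "card (insert g S) = VS.dim ?W + 1"
    using S \<open>g \<notin> S\<close> finite_subset[OF S(1) fin] by simp
  ultimately show ?thesis
    using False g S sub VS.dim_unique[of "insert g S" "RR_space \<iota> E"] by auto
qed simp

end

theorem theorem8p6:
  fixes \<iota> :: "'k::{field,finite} \<Rightarrow> 'f::field"
    and P Q :: "'f \<Rightarrow> int"
    and B :: "('f \<Rightarrow> int) \<Rightarrow>\<^sub>0 int"
    and a b :: int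
  assumes "function_field \<iota>"
    and "P \<in> rational_points \<iota>" and "Q \<in> rational_points \<iota>" and "P \<noteq> Q"
    and "B \<in> divisors \<iota>"
  defines "D \<equiv> (\<lambda>i j. B + frag_cmul i (frag_of P) + frag_cmul j (frag_of Q))"
  defines "N \<equiv> {(i, j). i \<le> a \<and> j \<le> b \<and> divisor_class \<iota> (D i j) \<in> discrepancies \<iota> P Q}"
  shows "(\<exists>S. finite S \<and> RR_space \<iota> (D a b) \<subseteq> module.span (const_scale \<iota>) S)
         \<and> finite N
         \<and> vector_space.dim (const_scale \<iota>) (RR_space \<iota> (D a b)) = card N"
proof -
  interpret function_field \<iota> by fact
  interpret finite_function_field \<iota> ..
  note P = \<open>P \<in> rational_points \<iota>\<close> and Q = \<open>Q \<in> rational_points \<iota>\<close>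
  have Pp: "P \<in> points \<iota>" and Qp: "Q \<in> points \<iota>"
    using P Q by (auto simp: rational_points_def)
  let ?L = "\<lambda>i j. RR_space \<iota> (D i j)"
  have cmul_divisor: "E + frag_cmul n (frag_of v) \<in> divisors \<iota>"
    if "E \<in> divisors \<iota>" "v \<in> points \<iota>" for E n v
    using that keys_add[of E "frag_cmul n (frag_of v)"] keys_cmul[of n "frag_of v"] by fastforce
  have D: "D i j \<in> divisors \<iota>" for i j
    unfolding D_def using \<open>B \<in> divisors \<iota>\<close> Pp Qp by (intro cmul_divisor)
  have D_P: "D i j - frag_of P = D (i - 1) j" and D_Q: "D i j - frag_of Q = D i (j - 1)" for i j
    by (simp_all add: D_def frag_cmul_diff_distrib algebra_simps)
  define jump where "jump i j \<longleftrightarrow> ?L i j \<noteq> ?L (i - 1) j" for i j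
  have disc: "divisor_class \<iota> (D i j) \<in> discrepancies \<iota> P Q \<longleftrightarrow> jump i j \<and> \<not> jump i (j - 1)" for i j
    by (simp add: divisor_class_in_discrepancies_iff[OF D] D_P D_Q jump_def)
  have lookup_D: "Poly_Mapping.lookup (D i j) v = Poly_Mapping.lookup B v
      + (if v = P then i else 0) + (if v = Q then j else 0)" for i j v
    by (simp add: D_def lookup_add)
  have L_mono: "?L i j \<subseteq> ?L i' j'" if "i \<le> i'" "j \<le> j'" for i i' j j'
    using that by (intro RR_space_mono) (auto simp: lookup_D)
  \<comment> \<open>As \<open>P \<noteq> Q\<close>, the extra condition at \<open>P\<close> does not
    involve \<open>j\<close>. A function witnessing a jump at \<open>(i, j)\<close> therefore
    witnesses one at \<open>(i, j')\<close> for each larger \<open>j'\<close>.\<close>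
  have L_P: "?L (i - 1) j = ?L i j \<inter> val_ge P (1 - i - Poly_Mapping.lookup B P)" for i j
    using RR_space_minus_point[OF Pp, of "D i j"] \<open>P \<noteq> Q\<close> by (simp add: D_P lookup_D algebra_simps)
  have jump_mono: "jump i j'" if "jump i j" "j \<le> j'" for i j j'
    using that L_mono[of i i j j'] unfolding jump_def L_P[of i] by blast
  have trivial_P: "\<exists>i0. \<forall>i\<le>i0. ?L i b = {0}"
    using eventually_RR_space_trivial[OF Q cmul_divisor[OF \<open>B \<in> divisors \<iota>\<close> Qp, of b] Pp]
    by (simp add: D_def add_ac)
  have trivial_Q: "\<exists>j0. \<forall>j\<le>j0. ?L i j = {0}" for i
    using eventually_RR_space_trivial[OF Q cmul_divisor[OF \<open>B \<in> divisors \<iota>\<close> Pp, of i] Qp]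
    by (simp add: D_def)
  have dim_0: "VS.dim {0} = 0"
    by (rule VS.dim_unique[of "{}"]) (simp_all add: VS.independent_empty)
  obtain i0 where i0: "\<And>i. i \<le> i0 \<Longrightarrow> ?L i b = {0}" using trivial_P by blast
  define J where "J i = {i'. i' \<le> i \<and> jump i' b}" for i
  have J_sub: "J i \<subseteq> {i0<..i}" for i
    using i0 by (force simp: J_def jump_def)
  then have J_finite: "finite (J i)" for i by (rule finite_subset) simp
  \<comment> \<open>The induction starts at \<open>i0\<close>, where the space is trivial and no
    jump has occurred.\<close>
  have dim: "VS.dim (?L i b) = card (J i)" if "i0 \<le> i" for i
    using that
  proof (induction i rule: int_ge_induct)
    case base
    have "J i0 = {}" using J_sub[of i0] by auto
    then show ?case using i0[of i0] dim_0 by simp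
  next
    case (step i)
    have J: "J (i + 1) = (if jump (i + 1) b then insert (i + 1) (J i) else J i)"
    proof -
      have "i' \<le> i + 1 \<longleftrightarrow> i' = i + 1 \<or> i' \<le> i" for i' by linarith
      then show ?thesis by (auto simp: J_def)
    qed
    have "VS.dim (?L (i + 1) b) = VS.dim (?L i b) + (if jump (i + 1) b then 1 else 0)"
      using dim_RR_space_step[OF P, of "D (i + 1) b"] finite_RR_space[OF Q D]
      by (simp add: D_P jump_def)
    moreover have "i + 1 \<notin> J i" by (simp add: J_def)
    ultimately show ?case using step.IH J J_finite by simp
  qed
  have dim_a: "VS.dim (?L a b) = card (J a)"
  proof (cases "i0 \<le> a")
    case False
    then have "J a = {}" using J_sub[of a] by auto
    then show ?thesis using i0[of a] False dim_0 by simp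
  qed (rule dim)
  \<comment> \<open>The second coordinate of a pair in \<open>N\<close> is determined by the first:
    it is where the jump in column \<open>i\<close> first appears.\<close>
  have bij: "bij_betw fst N (J a)"
    unfolding bij_betw_def
  proof
    have uniq: False if "jump i j" "\<not> jump i (j' - 1)" "j < j'" for i j j'
      using jump_mono[of i j "j' - 1"] that by simp
    show "inj_on fst N"
    proof (rule inj_onI, clarsimp simp: N_def disc)
      fix i j j' assume "jump i j" "\<not> jump i (j - 1)" "jump i j'" "\<not> jump i (j' - 1)"
      then show "j = j'" using uniq[of i j j'] uniq[of i j' j] by (meson linorder_neqE)
    qed
    show "fst ` N = J a"
    proof
      show "fst ` N \<subseteq> J a" using jump_mono by (auto simp: N_def disc J_def)
      show "J a \<subseteq> fst ` N"
      proof
        fix i assume "i \<in> J a"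
        then have i: "i \<le> a" "jump i b" by (auto simp: J_def)
        \<comment> \<open>A jump compares columns \<open>i\<close> and \<open>i - 1\<close>; at the
          smaller of the two bounds both spaces are trivial.\<close>
        obtain j0 j1 where "\<And>j. j \<le> j0 \<Longrightarrow> ?L i j = {0}" "\<And>j. j \<le> j1 \<Longrightarrow> ?L (i - 1) j = {0}"
          using trivial_Q by metis
        then have no_jump: "\<not> jump i (min j0 j1)" by (simp add: jump_def)
        then have "min j0 j1 \<le> b" using i jump_mono[of i b "min j0 j1"] by (meson linear)
        \<comment> \<open>A discrete intermediate value argument: between no jump at
          \<open>min j0 j1\<close> and a jump at \<open>b'\<close> there is a first
          appearance.\<close>
        have "\<exists>j\<le>b'. jump i j \<and> \<not> jump i (j - 1)" if "min j0 j1 \<le> b'" "jump i b'" for b'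
          using that
        proof (induction b' rule: int_ge_induct)
          case base
          then show ?case using no_jump by simp
        next
          case (step j)
          show ?case
          proof (cases "jump i j")
            case True
            then obtain j' where "j' \<le> j" "jump i j'" "\<not> jump i (j' - 1)"
              using step.IH by blast
            then show ?thesis by (intro exI[of _ j']) simp
          next
            case False
            then show ?thesis using step.prems by (intro exI[of _ "j + 1"]) simp
          qed
        qed
        then obtain j where "j \<le> b" "jump i j" "\<not> jump i (j - 1)"
          using i \<open>min j0 j1 \<le> b\<close> by blast
        then have "(i, j) \<in> N" using i by (simp add: N_def disc)
        then show "i \<in> fst ` N" by force
      qed
    qed
  qed
  have "finite N" using bij_betw_finite[OF bij] J_finite by simp
  moreover have "VS.dim (?L a b) = card N" using dim_a bij_betw_same_card[OF bij] by simp
  \<comment> \<open>The space is finite as a set, so it serves as its own finite spanning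
    set.\<close>
  moreover have "?L a b \<subseteq> VS.span (?L a b)" by (rule VS.span_superset)
  ultimately show ?thesis using finite_RR_space[OF Q D] by blast
qed

end
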